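(* Let $p\ge 1$ and let $g:\mathbb{R}^n\times\mathbb{R}^m\to\mathbb{R}$ be $p$ times differentiable, $\mu$-strongly convex in $x$ and $\mu$-strongly concave in $y$ (with $\mu>0$). Let $F(z)=(\nabla_x g(x,y),-\nabla_y g(x,y))$, $z=(x,y)$, so that $F$ is $\mu$-strongly monotone, and assume that $F$ is $p$-th order Lipschitz with constant $L_p$, i.e. $\|\nabla^{p-1}F(z_1)-\nabla^{p-1}F(z_2)\|_2\le L_p\|z_1-z_2\|_2$ for all $z_1,z_2$ (equivalently, $\nabla^p g$ is $L_p$-Lipschitz). Let $z^*$ be the saddle point of $g$, let $z_1\in\mathbb{R}^n\times\mathbb{R}^m$, let $R\ge\|z_1-z^*\|_2$ and $0<\varepsilon_G<1$. Then the complexity of the method Restarted HighOrderMirrorProx (defined in the context) for finding an $\varepsilon_G$-approximate solution of $\min_x\max_y g(x,y)$, that is, a point $(\tilde x,\tilde y)$ with duality gap $G(\tilde x,\tilde y)\le\varepsilon_G$, measured as the total number of inner HighOrderMirrorProx iterations $\sum_i T_i$, is $$O\left(\left(\frac{L_pR^{p-1}}{\mu}\right)^{\frac{2}{p+1}}\log\frac{\mu R^2}{\varepsilon_G}\right).$$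
   Context: $\|\cdot\|_2$ is the Euclidean norm for vectors; for derivative tensors it is the operator norm $\|A\|_2=\max\{|A[h_1,\dots,h_p]|:\|h_i\|_2\le 1\}$. $\log$ is the base-2 logarithm and $O(\cdot)$ hides numerical constants. Strong convexity/concavity: for all arguments, $\langle\nabla_xg(x_1,y)-\nabla_xg(x_2,y),x_1-x_2\rangle\ge\mu\|x_1-x_2\|_2^2$ and $\langle-\nabla_yg(x,y_1)+\nabla_yg(x,y_2),y_1-y_2\rangle\ge\mu\|y_1-y_2\|_2^2$. Strong monotonicity: $\langle F(z_1)-F(z_2),z_1-z_2\rangle\ge\mu\|z_1-z_2\|_2^2$. Duality gap: $G(x,y)=\max_{y'\in\mathbb{R}^m}g(x,y')-\min_{x'\in\mathbb{R}^n}g(x',y)$. $\Phi^F_{z,q}(\hat z)=\sum_{i=0}^{q}\frac1{i!}\nabla^iF(z)[\hat z-z]^i$ is the Taylor approximation of $F$ at $z$ of order $q$. $D(z_1,z_2)=\frac12\|z_1-z_2\|_2^2$. $\mathcal Z=\mathbb{R}^n\times\mathbb{R}^m$. Method HighOrderMirrorProx (input: starting point $z_1$, order $p\ge1$, number of iterations $T>0$). For $t=1,\dots,T$: determine $\gamma_t>0$ and $\hat z_t$ such that $\hat z_t=\arg\min_{z\in\mathcal Z}\{\gamma_t\langle\Phi^F_{z_t,p-1}(\hat z_t),z-z_t\rangle+D(z,z_t)\}$ and $\frac{p!}{32L_p\|\hat z_t-z_t\|_2^{p-1}}\le\gamma_t\le\frac{p!}{16L_p\|\hat z_t-z_t\|_2^{p-1}}$;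 then set $z_{t+1}=\arg\min_{z\in\mathcal Z}\{\langle\gamma_tF(\hat z_t),z-\hat z_t\rangle+D(z,z_t)\}$. Return $\bar z_T=\frac1{\Gamma_T}\sum_{t=1}^T\gamma_t\hat z_t$ with $\Gamma_T=\sum_{t=1}^T\gamma_t$. Method Restarted HighOrderMirrorProx (input: $z_1$, $p\ge1$, $0<\varepsilon_G<1$, $R\ge\|z_1-z^*\|_2$). Set $\tilde z_1=z_1$ and $k=\lceil\frac12\log\frac{\mu R^2}{\varepsilon_G}\rceil$. For $i=1,\dots,k$: set $R_i=R/2^{i-1}$, $T_i=\left\lceil\left(\frac{64L_pR_i^{p-1}}{\mu}\right)^{\frac2{p+1}}\right\rceil$, run HighOrderMirrorProx from $\tilde z_i$ with order $p$ and $T_i$ iterations, and let $\tilde z_{i+1}=\bar z_{T_i}$ be its output. Return the last point $\tilde z_{k+1}$.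
   Formalization: Assumes ε_G < μR² (otherwise no restart is made and the gap can exceed ε_G); each factor of the bound is replaced by its maximum with 1, since every T_i and k is at least 1; for p = 1 the method is run with accuracy input ε_G/5, since with ε_G the gap can exceed ε_G. *)

theory Defs
  imports "HOL-Analysis.Analysis"
begin

subsection \<open>Higher derivatives\<close>

text \<open>
  \<open>iter_deriv f z [h\<^sub>1, \<dots>, h\<^sub>i]\<close> is the value \<open>\<nabla>\<^sup>i f(z)[h\<^sub>1, \<dots>, h\<^sub>i]\<close> of the \<open>i\<close>-th Frechet derivative
  tensor, so a derivative tensor of order \<open>i\<close> is represented as a function on lists of length \<open>i\<close>.
  The head of the list is the direction of the last differentiation.
\<close>

fun iter_deriv ::
    "('a::real_normed_vector \<Rightarrow> 'b::real_normed_vector) \<Rightarrow> 'a \<Rightarrow> 'a list \<Rightarrow> 'b" where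
  "iter_deriv f z [] = f z"
| "iter_deriv f z (h # hs) = frechet_derivative (\<lambda>w. iter_deriv f w hs) (at z) h"

text \<open>
  On a finite-dimensional domain a tensor-valued map is differentiable iff all its evaluations at
  fixed arguments are, so differentiability of the derivative of order \<open>i < k\<close> can be required
  evaluation by evaluation.
\<close>

definition times_differentiable ::
    "nat \<Rightarrow> ('a::euclidean_space \<Rightarrow> 'b::real_normed_vector) \<Rightarrow> bool" where
  "times_differentiable k f \<longleftrightarrow>
     (\<forall>hs z. length hs < k \<longrightarrow> (\<lambda>w. iter_deriv f w hs) differentiable (at z))"

text \<open>
  For a vector-valued tensor the absolute value in the operator norm is the norm of the target
  space. This is the same as pairing the value with one more unit direction. The tensors to which
  this is applied are multilinear on a finite-dimensional space, hence the supremum is finite.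
\<close>

definition tensor_norm :: "nat \<Rightarrow> ('a::real_normed_vector list \<Rightarrow> 'b::real_normed_vector) \<Rightarrow> real" where
  "tensor_norm i A = Sup {norm (A hs) | hs. length hs = i \<and> (\<forall>h\<in>set hs. norm h \<le> 1)}"

definition order_lipschitz ::
    "nat \<Rightarrow> real \<Rightarrow> ('a::euclidean_space \<Rightarrow> 'b::real_normed_vector) \<Rightarrow> bool" where
  "order_lipschitz p L F \<longleftrightarrow>
     (\<forall>z1 z2. tensor_norm (p - 1) (\<lambda>hs. iter_deriv F z1 hs - iter_deriv F z2 hs)
                \<le> L * norm (z1 - z2))"

definition taylor ::
    "('a::real_normed_vector \<Rightarrow> 'b::real_normed_vector) \<Rightarrow> 'a \<Rightarrow> nat \<Rightarrow> 'a \<Rightarrow> 'b" where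
  "taylor F z q zh = (\<Sum>i=0..q. (1 / fact i) *\<^sub>R iter_deriv F z (replicate i (zh - z)))"


subsection \<open>Saddle point problems\<close>

definition grad :: "('a::real_inner \<Rightarrow> real) \<Rightarrow> 'a \<Rightarrow> 'a" where
  "grad f x = (THE D. GDERIV f x :> D)"

definition grad_x :: "('a::real_inner \<times> 'b::real_inner \<Rightarrow> real) \<Rightarrow> 'a \<Rightarrow> 'b \<Rightarrow> 'a" where
  "grad_x g x y = grad (\<lambda>x'. g (x', y)) x"

definition grad_y :: "('a::real_inner \<times> 'b::real_inner \<Rightarrow> real) \<Rightarrow> 'a \<Rightarrow> 'b \<Rightarrow> 'b" where
  "grad_y g x y = grad (\<lambda>y'. g (x, y')) y"

definition saddle_field :: "('a::real_inner \<times> 'b::real_inner \<Rightarrow> real) \<Rightarrow> 'a \<times> 'b \<Rightarrow> 'a \<times> 'b" where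
  "saddle_field g z = (grad_x g (fst z) (snd z), - grad_y g (fst z) (snd z))"

definition strongly_convex_x :: "real \<Rightarrow> ('a::real_inner \<times> 'b::real_inner \<Rightarrow> real) \<Rightarrow> bool" where
  "strongly_convex_x \<mu> g \<longleftrightarrow>
     (\<forall>x1 x2 y. (grad_x g x1 y - grad_x g x2 y) \<bullet> (x1 - x2) \<ge> \<mu> * (norm (x1 - x2))\<^sup>2)"

definition strongly_concave_y :: "real \<Rightarrow> ('a::real_inner \<times> 'b::real_inner \<Rightarrow> real) \<Rightarrow> bool" where
  "strongly_concave_y \<mu> g \<longleftrightarrow>
     (\<forall>x y1 y2. (- grad_y g x y1 + grad_y g x y2) \<bullet> (y1 - y2) \<ge> \<mu> * (norm (y1 - y2))\<^sup>2)"

definition saddle_point :: "('a \<times> 'b \<Rightarrow> real) \<Rightarrow> 'a \<times> 'b \<Rightarrow> bool" where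
  "saddle_point g z \<longleftrightarrow>
     (\<forall>y. g (fst z, y) \<le> g z) \<and> (\<forall>x. g z \<le> g (x, snd z))"

text \<open>
  If \<open>g\<close> is differentiable, strongly convex in \<open>x\<close> and strongly concave in \<open>y\<close>, the supremum and the
  infimum are attained.
\<close>

definition duality_gap :: "('a \<times> 'b \<Rightarrow> real) \<Rightarrow> 'a \<times> 'b \<Rightarrow> real" where
  "duality_gap g z = (SUP y'. g (fst z, y')) - (INF x'. g (x', snd z))"


subsection \<open>The methods\<close>

definition half_sq_dist :: "'a::real_normed_vector \<Rightarrow> 'a \<Rightarrow> real" where
  "half_sq_dist z1 z2 = 1 / 2 * (norm (z1 - z2))\<^sup>2"

text \<open>
  The methods leave freedom in the choice of \<open>\<gamma>\<^sub>t\<close> and \<open>\<hat>z\<^sub>t\<close>, so they are relations between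
  input and output. The condition on \<open>zh\<close> is implicit: \<open>zh\<close> also occurs in the objective it minimizes.
  If \<open>zh = z\<close> and \<open>p \<ge> 2\<close>, the bounds on \<open>\<gamma>\<close> are \<open>1 / 0 = 0\<close>, so no \<open>\<gamma> > 0\<close> is admissible; with the
  reading \<open>1 / 0 = \<infinity>\<close> no real \<open>\<gamma>\<close> would be admissible either.
\<close>

definition mirror_prox_step ::
    "('a::euclidean_space \<Rightarrow> 'a) \<Rightarrow> nat \<Rightarrow> real \<Rightarrow> 'a \<Rightarrow> real \<Rightarrow> 'a \<Rightarrow> 'a \<Rightarrow> bool" where
  "mirror_prox_step F p L z \<gamma> zh z' \<longleftrightarrow>
     \<gamma> > 0 \<and>
     is_arg_min (\<lambda>w. \<gamma> * (taylor F z (p - 1) zh \<bullet> (w - z)) + half_sq_dist w z) (\<lambda>_. True) zh \<and>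
     fact p / (32 * L * norm (zh - z) ^ (p - 1)) \<le> \<gamma> \<and>
     \<gamma> \<le> fact p / (16 * L * norm (zh - z) ^ (p - 1)) \<and>
     is_arg_min (\<lambda>w. (\<gamma> *\<^sub>R F zh) \<bullet> (w - zh) + half_sq_dist w z) (\<lambda>_. True) z'"

definition mirror_prox_output ::
    "('a::euclidean_space \<Rightarrow> 'a) \<Rightarrow> nat \<Rightarrow> real \<Rightarrow> nat \<Rightarrow> 'a \<Rightarrow> 'a \<Rightarrow> bool" where
  "mirror_prox_output F p L T z1 zbar \<longleftrightarrow>
     (\<exists>z \<gamma> zh. z 1 = z1 \<and>
        (\<forall>t\<in>{1..T}. mirror_prox_step F p L (z t) (\<gamma> t) (zh t) (z (Suc t))) \<and>
        zbar = (1 / (\<Sum>t=1..T. \<gamma> t)) *\<^sub>R (\<Sum>t=1..T. \<gamma> t *\<^sub>R zh t))"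

definition num_restarts :: "real \<Rightarrow> real \<Rightarrow> real \<Rightarrow> nat" where
  "num_restarts \<mu> R \<epsilon> = nat \<lceil>1 / 2 * log 2 (\<mu> * R\<^sup>2 / \<epsilon>)\<rceil>"

definition restart_radius :: "real \<Rightarrow> nat \<Rightarrow> real" where
  "restart_radius R i = R / 2 ^ (i - 1)"

definition inner_iterations :: "nat \<Rightarrow> real \<Rightarrow> real \<Rightarrow> real \<Rightarrow> nat \<Rightarrow> nat" where
  "inner_iterations p L \<mu> R i =
     nat \<lceil>(64 * L * restart_radius R i ^ (p - 1) / \<mu>) powr (2 / (real p + 1))\<rceil>"

definition restarted_output ::
    "('a::euclidean_space \<Rightarrow> 'a) \<Rightarrow> nat \<Rightarrow> real \<Rightarrow> real \<Rightarrow> real \<Rightarrow> real \<Rightarrow> 'a \<Rightarrow> 'a \<Rightarrow> bool" where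
  "restarted_output F p L \<mu> R \<epsilon> z1 out \<longleftrightarrow>
     (\<exists>zt. zt 1 = z1 \<and>
        (\<forall>i\<in>{1..num_restarts \<mu> R \<epsilon>}.
           mirror_prox_output F p L (inner_iterations p L \<mu> R i) (zt i) (zt (Suc i))) \<and>
        out = zt (Suc (num_restarts \<mu> R \<epsilon>)))"

definition total_iterations :: "nat \<Rightarrow> real \<Rightarrow> real \<Rightarrow> real \<Rightarrow> real \<Rightarrow> nat" where
  "total_iterations p L \<mu> R \<epsilon> = (\<Sum>i=1..num_restarts \<mu> R \<epsilon>. inner_iterations p L \<mu> R i)"

text \<open>
  The accuracy with which the method is run in order to reach duality gap \<open>\<epsilon>\<close>. For \<open>p \<ge> 2\<close> it is \<open>\<epsilon>\<close>
  itself. For \<open>p = 1\<close> the output of the method with accuracy \<open>\<epsilon>\<close> may have a duality gap greater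
  than \<open>\<epsilon>\<close> (only \<open>9/2 * \<epsilon>\<close> is guaranteed), so a numerical factor is needed; it changes the number
  of iterations by a numerical factor only. Example for \<open>\<mu> = 1\<close>: \<open>g (x, y) =
  x\<^sup>2/2 - y\<^sup>2/2 + c*x*y + (B/2) * (max 0 (a - x))\<^sup>2\<close> with \<open>c = 40\<close>, \<open>B = 30000\<close>, \<open>a = -0.38\<close>,
  \<open>L = 1 + B + c\<close>, \<open>\<gamma>\<^sub>t = 1/(32*L)\<close>, start \<open>(cos 0.785, sin 0.785)\<close>, \<open>R = 1\<close>, \<open>\<epsilon> = 1/4\<close>; a
  floating-point run of the method returns a point with gap about \<open>0.32\<close>.
\<close>

definition run_accuracy :: "nat \<Rightarrow> real \<Rightarrow> real" where
  "run_accuracy p \<epsilon> = (if p = 1 then \<epsilon> / 5 else \<epsilon>)"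

end

theory Submission
  imports Defs
begin

text \<open>
  Write \<open>r\<^sub>t = \<parallel>\<hat>z\<^sub>t - z\<^sub>t\<parallel>\<close>, \<open>S = \<Sum> r\<^sub>t\<^sup>2\<close> and \<open>\<Gamma> = \<Sum> \<gamma>\<^sub>t\<close>. By Taylor's theorem
  \<open>\<parallel>F(\<hat>z\<^sub>t) - \<Phi>(\<hat>z\<^sub>t)\<parallel> \<le> L r\<^sub>t\<^sup>p / p!\<close>, so the upper bound on \<open>\<gamma>\<^sub>t\<close> puts \<open>z\<^sub>t\<^sub>+\<^sub>1\<close> within \<open>r\<^sub>t / 16\<close> of \<open>\<hat>z\<^sub>t\<close>, and
  the mirror prox inequality reads
  \<open>\<Sum> \<gamma>\<^sub>t \<langle>F(\<hat>z\<^sub>t), \<hat>z\<^sub>t - u\<rangle> \<le> \<parallel>z\<^sub>1 - u\<parallel>\<^sup>2/2 - (255/512) S\<close> for every \<open>u\<close>. Strong convexity-concavity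
  bounds the left side below by \<open>\<Gamma> (g(xbar, v) - g(w, ybar) + (\<mu>/2) \<parallel>zbar - u\<parallel>\<^sup>2)\<close> for \<open>u = (w, v)\<close>. With
  \<open>u = z\<^sup>*\<close> this makes the distance to \<open>z\<^sup>*\<close> contract. For arbitrary \<open>u\<close> the quadratic term on the left
  absorbs the unbounded part of \<open>\<parallel>z\<^sub>1 - u\<parallel>\<^sup>2\<close>, which bounds the duality gap although \<open>\<nabla>g\<close> need not be
  Lipschitz. The lower bound on \<open>\<gamma>\<^sub>t\<close> and the power mean inequality bound \<open>\<Gamma>\<close> from below in terms of
  \<open>T\<close> and \<open>S\<close>.
\<close>

subsection \<open>Higher derivatives and Taylor approximation\<close>

text \<open>The end of the list is differentiated first, so cutting a suffix off replaces
  \<open>f\<close> by one of its directional derivatives. This permits induction from the inside of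
  the iterated derivative.\<close>

lemma iter_deriv_append:
  "iter_deriv f z (hs @ hs') = iter_deriv (\<lambda>w. iter_deriv f w hs') z hs"
  by (induction hs arbitrary: z) simp_all

lemma times_differentiable_mono:
  "times_differentiable k f \<Longrightarrow> j \<le> k \<Longrightarrow> times_differentiable j f"
  unfolding times_differentiable_def by (meson less_le_trans)

lemma times_differentiable_has_derivative:
  assumes "times_differentiable k f" and "length hs < k"
  shows "((\<lambda>w. iter_deriv f w hs) has_derivative (\<lambda>h. iter_deriv f z (h # hs))) (at z)"
  using assms unfolding times_differentiable_def iter_deriv.simps(2)
  by (metis frechet_derivative_works)

text \<open>Serves two expansions: of a direction in the basis, and of the saddle field in the
  directional derivatives of \<open>g\<close>.\<close>

lemma iter_deriv_sum_linear:
  fixes f :: "'i \<Rightarrow> 'a::euclidean_space \<Rightarrow> 'b::real_normed_vector"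
  assumes lin: "\<And>b. b \<in> B \<Longrightarrow> bounded_linear (A b)"
    and diff: "\<And>b. b \<in> B \<Longrightarrow> times_differentiable (length hs) (f b)"
  shows "iter_deriv (\<lambda>w. \<Sum>b\<in>B. A b (f b w)) z hs = (\<Sum>b\<in>B. A b (iter_deriv (f b) z hs))"
  using diff
proof (induction hs arbitrary: z)
  case (Cons h hs)
  have IH: "iter_deriv (\<lambda>w. \<Sum>b\<in>B. A b (f b w)) w hs = (\<Sum>b\<in>B. A b (iter_deriv (f b) w hs))" for w
    using Cons.prems by (intro Cons.IH) (auto intro: times_differentiable_mono[of "Suc (length hs)"])
  have "((\<lambda>w. \<Sum>b\<in>B. A b (iter_deriv (f b) w hs)) has_derivative
      (\<lambda>h. \<Sum>b\<in>B. A b (iter_deriv (f b) z (h # hs)))) (at z)"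
    using Cons.prems
    by (intro has_derivative_sum bounded_linear.has_derivative[OF lin]
        times_differentiable_has_derivative) auto
  from frechet_derivative_at[OF this] show ?case
    by (simp add: IH fun_eq_iff)
qed simp

lemma times_differentiable_sum_linear:
  fixes f :: "'i \<Rightarrow> 'a::euclidean_space \<Rightarrow> 'b::real_normed_vector"
  assumes lin: "\<And>b. b \<in> B \<Longrightarrow> bounded_linear (A b)"
    and diff: "\<And>b. b \<in> B \<Longrightarrow> times_differentiable k (f b)"
  shows "times_differentiable k (\<lambda>w. \<Sum>b\<in>B. A b (f b w))"
  unfolding times_differentiable_def
proof (intro allI impI)
  fix hs :: "'a list" and z assume k: "length hs < k"
  have "iter_deriv (\<lambda>w. \<Sum>b\<in>B. A b (f b w)) w hs = (\<Sum>b\<in>B. A b (iter_deriv (f b) w hs))" for w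
    using diff k by (intro iter_deriv_sum_linear lin) (auto intro: times_differentiable_mono[of k])
  moreover have "((\<lambda>w. \<Sum>b\<in>B. A b (iter_deriv (f b) w hs)) has_derivative
      (\<lambda>h. \<Sum>b\<in>B. A b (iter_deriv (f b) z (h # hs)))) (at z)"
    using diff k by (intro has_derivative_sum bounded_linear.has_derivative[OF lin]
        times_differentiable_has_derivative) auto
  ultimately show "(\<lambda>w. iter_deriv (\<lambda>w. \<Sum>b\<in>B. A b (f b w)) w hs) differentiable at z"
    unfolding differentiable_def by auto
qed

lemma times_differentiable_frechet_derivative:
  fixes f :: "'a::euclidean_space \<Rightarrow> 'b::real_normed_vector"
  assumes "times_differentiable (Suc k) f"
  shows "times_differentiable k (\<lambda>w. frechet_derivative f (at w) h)"
  unfolding times_differentiable_def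
proof (intro allI impI)
  fix hs :: "'a list" and z assume "length hs < k"
  then have "(\<lambda>w. iter_deriv f w (hs @ [h])) differentiable at z"
    using assms unfolding times_differentiable_def by auto
  then show "(\<lambda>w. iter_deriv (\<lambda>w. frechet_derivative f (at w) h) w hs) differentiable at z"
    by (simp add: iter_deriv_append)
qed

lemma frechet_derivative_basis_expansion:
  fixes f :: "'a::euclidean_space \<Rightarrow> 'b::real_normed_vector"
  assumes "f differentiable (at w)"
  shows "frechet_derivative f (at w) h = (\<Sum>b\<in>Basis. (h \<bullet> b) *\<^sub>R frechet_derivative f (at w) b)"
proof -
  have "linear (frechet_derivative f (at w))"
    using assms by (rule linear_frechet_derivative)
  then have "frechet_derivative f (at w) (\<Sum>b\<in>Basis. (h \<bullet> b) *\<^sub>R b)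
      = (\<Sum>b\<in>Basis. (h \<bullet> b) *\<^sub>R frechet_derivative f (at w) b)"
    by (simp add: linear_sum linear_scale)
  then show ?thesis
    by (simp add: euclidean_representation)
qed

lemma times_differentiable_imp_differentiable:
  "times_differentiable k f \<Longrightarrow> k > 0 \<Longrightarrow> f differentiable (at w)"
  unfolding times_differentiable_def by (drule spec[of _ "[]"]) simp

text \<open>Splitting off the last list entry and expanding it in \<open>Basis\<close> reduces the
  order by one; the coefficients of a vector of norm at most 1 are at most 1 in absolute value. The
  bound makes the set in \<open>tensor_norm\<close> bounded above, so that its \<open>Sup\<close>
  really dominates its elements.\<close>

lemma iter_deriv_bounded:
  assumes "times_differentiable k f"
  shows "\<exists>C. \<forall>hs. length hs = k \<and> (\<forall>h\<in>set hs. norm h \<le> 1) \<longrightarrow> norm (iter_deriv f z hs) \<le> C"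
  using assms
proof (induction k arbitrary: f)
  case (Suc k)
  let ?D = "\<lambda>b w. frechet_derivative f (at w) b"
  have diff: "times_differentiable k (?D b)" for b
    by (rule times_differentiable_frechet_derivative[OF Suc.prems])
  have "\<forall>b. \<exists>C. \<forall>hs. length hs = k \<and> (\<forall>h\<in>set hs. norm h \<le> 1)
      \<longrightarrow> norm (iter_deriv (?D b) z hs) \<le> C"
    using Suc.IH[OF diff] by blast
  then obtain C where C: "\<And>b hs. length hs = k \<Longrightarrow> (\<forall>h\<in>set hs. norm h \<le> 1)
      \<Longrightarrow> norm (iter_deriv (?D b) z hs) \<le> C b"
    by metis
  have "norm (iter_deriv f z hs) \<le> (\<Sum>b\<in>Basis. C b)"
    if hs: "length hs = Suc k" "\<forall>h\<in>set hs. norm h \<le> 1" for hs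
  proof -
    obtain gs h where hs_eq: "hs = gs @ [h]"
      using hs(1) by (metis length_Suc_conv_rev)
    have gs: "length gs = k" "\<forall>h\<in>set gs. norm h \<le> 1" and h: "norm h \<le> 1"
      using hs hs_eq by auto
    have "?D h = (\<lambda>w. \<Sum>b\<in>Basis. (h \<bullet> b) *\<^sub>R ?D b w)"
      using frechet_derivative_basis_expansion times_differentiable_imp_differentiable[OF Suc.prems]
      by blast
    moreover have "iter_deriv f z hs = iter_deriv (?D h) z gs"
      by (simp add: hs_eq iter_deriv_append)
    ultimately have "iter_deriv f z hs = iter_deriv (\<lambda>w. \<Sum>b\<in>Basis. (h \<bullet> b) *\<^sub>R ?D b w) z gs"
      by simp
    also have "\<dots> = (\<Sum>b\<in>Basis. (h \<bullet> b) *\<^sub>R iter_deriv (?D b) z gs)"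
      by (rule iter_deriv_sum_linear) (auto simp: bounded_linear_scaleR_right diff gs(1))
    finally have "norm (iter_deriv f z hs) \<le> (\<Sum>b\<in>Basis. norm ((h \<bullet> b) *\<^sub>R iter_deriv (?D b) z gs))"
      by (simp only: norm_sum)
    also have "\<dots> \<le> (\<Sum>b\<in>Basis. C b)"
    proof (rule sum_mono)
      fix b :: 'a assume b: "b \<in> Basis"
      have "\<bar>h \<bullet> b\<bar> \<le> 1"
        using Basis_le_norm[OF b, of h] h by simp
      then have "norm ((h \<bullet> b) *\<^sub>R iter_deriv (?D b) z gs) \<le> 1 * norm (iter_deriv (?D b) z gs)"
        unfolding norm_scaleR by (intro mult_right_mono) auto
      then show "norm ((h \<bullet> b) *\<^sub>R iter_deriv (?D b) z gs) \<le> C b"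
        using C[OF gs, of b] by linarith
    qed
    finally show ?thesis .
  qed
  then show ?case by blast
qed auto

lemma iter_deriv_scale:
  assumes "times_differentiable (length hs) f"
  shows "iter_deriv f z (map ((*\<^sub>R) c) hs) = c ^ length hs *\<^sub>R iter_deriv f z hs"
  using assms
proof (induction hs arbitrary: z)
  case (Cons h hs)
  have IH: "(\<lambda>w. iter_deriv f w (map ((*\<^sub>R) c) hs)) = (\<lambda>w. c ^ length hs *\<^sub>R iter_deriv f w hs)"
    using Cons.IH times_differentiable_mono[OF Cons.prems, of "length hs"] by auto
  have D: "((\<lambda>w. iter_deriv f w hs) has_derivative (\<lambda>h. iter_deriv f z (h # hs))) (at z)"
    using Cons.prems by (intro times_differentiable_has_derivative) auto
  from frechet_derivative_at[OF has_derivative_scaleR_right[OF this, of "c ^ length hs"]]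
  have "iter_deriv f z (map ((*\<^sub>R) c) (h # hs)) = c ^ length hs *\<^sub>R iter_deriv f z ((c *\<^sub>R h) # hs)"
    by (simp add: IH del: iter_deriv.simps(2) add: iter_deriv.simps(2)[of f z "c *\<^sub>R h" "map _ _"] fun_eq_iff)
  also have "iter_deriv f z ((c *\<^sub>R h) # hs) = c *\<^sub>R iter_deriv f z (h # hs)"
    using linear_scale[OF has_derivative_linear[OF D]] .
  finally show ?case by (simp add: mult.commute)
qed simp

lemma order_lipschitz_replicate:
  fixes F :: "'a::euclidean_space \<Rightarrow> 'b::real_normed_vector"
  assumes lip: "order_lipschitz p L F" and diff: "times_differentiable (p - 1) F"
  shows "norm (iter_deriv F z1 (replicate (p - 1) h) - iter_deriv F z2 (replicate (p - 1) h))
    \<le> L * norm (z1 - z2) * norm h ^ (p - 1)"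
proof -
  let ?n = "p - 1"
  let ?A = "\<lambda>hs. iter_deriv F z1 hs - iter_deriv F z2 hs"
  let ?S = "{norm (?A hs) | hs. length hs = ?n \<and> (\<forall>h\<in>set hs. norm h \<le> 1)}"
  obtain C1 C2 where
    C1: "\<And>hs. length hs = ?n \<and> (\<forall>h\<in>set hs. norm h \<le> 1) \<Longrightarrow> norm (iter_deriv F z1 hs) \<le> C1" and
    C2: "\<And>hs. length hs = ?n \<and> (\<forall>h\<in>set hs. norm h \<le> 1) \<Longrightarrow> norm (iter_deriv F z2 hs) \<le> C2"
    using iter_deriv_bounded[OF diff, of z1] iter_deriv_bounded[OF diff, of z2] by metis
  have bdd: "bdd_above ?S"
  proof (rule bdd_aboveI)
    fix x assume "x \<in> ?S"
    then obtain hs where hs: "x = norm (?A hs)" "length hs = ?n \<and> (\<forall>h\<in>set hs. norm h \<le> 1)"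
      by blast
    show "x \<le> C1 + C2"
      using C1[OF hs(2)] C2[OF hs(2)] norm_triangle_ineq4[of "iter_deriv F z1 hs" "iter_deriv F z2 hs"]
      unfolding hs(1) by linarith
  qed
  \<comment> \<open>Normalization to the unit ball. For \<open>h = 0\<close> it gives
    \<open>e = 0\<close>, and \<open>h = norm h *\<^sub>R e\<close> still holds.\<close>
  define e where "e = sgn h"
  have e: "norm e \<le> 1" by (simp add: e_def norm_sgn)
  have "replicate ?n h = map ((*\<^sub>R) (norm h)) (replicate ?n e)"
    by (cases "h = 0") (simp_all add: e_def sgn_div_norm)
  then have "?A (replicate ?n h) = norm h ^ ?n *\<^sub>R ?A (replicate ?n e)"
    using diff by (simp only: iter_deriv_scale length_replicate scaleR_diff_right)
  then have "norm (?A (replicate ?n h)) = norm h ^ ?n * norm (?A (replicate ?n e))"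
    by simp
  also have "\<dots> \<le> norm h ^ ?n * (L * norm (z1 - z2))"
  proof (rule mult_left_mono)
    have "norm (?A (replicate ?n e)) \<le> Sup ?S"
    proof (rule cSup_upper[OF _ bdd])
      show "norm (?A (replicate ?n e)) \<in> ?S"
        using e by (intro CollectI exI[of _ "replicate ?n e"]) auto
    qed
    also have "Sup ?S \<le> L * norm (z1 - z2)"
      using lip unfolding order_lipschitz_def tensor_norm_def by simp
    finally show "norm (?A (replicate ?n e)) \<le> L * norm (z1 - z2)" .
  qed simp
  finally show ?thesis
    by (simp add: mult.commute)
qed

text \<open>Only growth of the top function away from its value at 0 is assumed, which is what a
  Lipschitz derivative provides. The derivative of the remainder is the remainder of the shifted
  family, and the bound differentiates to the bound of one order less, so the mean value inequality
  closes the induction.\<close>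

lemma taylor_remainder_bound:
  fixes \<phi> :: "nat \<Rightarrow> real \<Rightarrow> 'b::real_normed_vector"
  assumes deriv: "\<And>i s. i < n \<Longrightarrow> (\<phi> i has_vector_derivative \<phi> (Suc i) s) (at s)"
    and bound: "\<And>s. 0 \<le> s \<Longrightarrow> norm (\<phi> n s - \<phi> n 0) \<le> C * s"
    and "0 \<le> s"
  shows "norm (\<phi> 0 s - (\<Sum>i\<le>n. (s ^ i / fact i) *\<^sub>R \<phi> i 0)) \<le> C * s ^ Suc n / fact (Suc n)"
  using assms
proof (induction n arbitrary: \<phi> s)
  case (Suc n)
  let ?\<psi> = "\<lambda>s. \<phi> 0 s - (\<Sum>i\<le>Suc n. (s ^ i / fact i) *\<^sub>R \<phi> i 0)"
  let ?\<psi>' = "\<lambda>s. \<phi> (Suc 0) s - (\<Sum>i\<le>n. (s ^ i / fact i) *\<^sub>R \<phi> (Suc i) 0)"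
  let ?b = "\<lambda>s. C * s ^ Suc (Suc n) / fact (Suc (Suc n))"
  let ?b' = "\<lambda>s. C * s ^ Suc n / fact (Suc n)"
  have IH: "norm (?\<psi>' t) \<le> ?b' t" if "0 \<le> t" for t
    using Suc.IH[of "\<lambda>i. \<phi> (Suc i)" t] Suc.prems(1,2) that by simp
  have \<psi>': "(?\<psi> has_vector_derivative ?\<psi>' t) (at t)" for t
  proof -
    have pow: "((\<lambda>s::real. s ^ Suc i / fact (Suc i)) has_real_derivative t ^ i / fact i) (at t)" for i
      using DERIV_cdivide[OF DERIV_pow[of "Suc i"], of "fact (Suc i)"] by (simp del: of_nat_Suc)
    have "((\<lambda>s. \<phi> 0 s - (\<phi> 0 0 + (\<Sum>i\<le>n. (s ^ Suc i / fact (Suc i)) *\<^sub>R \<phi> (Suc i) 0)))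
        has_vector_derivative \<phi> (Suc 0) t - (0 + (\<Sum>i\<le>n. (t ^ i / fact i) *\<^sub>R \<phi> (Suc i) 0))) (at t)"
      by (intro has_vector_derivative_diff has_vector_derivative_add has_vector_derivative_sum
          has_vector_derivative_const Suc.prems(1))
        (use has_vector_derivative_scaleR[OF pow has_vector_derivative_const] in
          \<open>auto simp del: fact_Suc power_Suc\<close>)
    then show ?thesis
      by (simp add: sum.atMost_Suc_shift del: sum.atMost_Suc fact_Suc power_Suc)
  qed
  have b': "(?b has_real_derivative ?b' t) (at t)" for t
    using DERIV_cdivide[OF DERIV_cmult[OF DERIV_pow[of "Suc (Suc n)"], of C], of "fact (Suc (Suc n))"]
    by (simp del: of_nat_Suc power_Suc)
  have 0: "?\<psi> 0 = 0"
    by (simp add: sum.atMost_Suc_shift del: sum.atMost_Suc)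
  show ?case
  proof (cases "s = 0")
    case False
    have "norm (?\<psi> s - ?\<psi> 0) \<le> ?b s - ?b 0"
    proof (rule differentiable_bound_general)
      show "0 < s" using False Suc.prems(3) by simp
      show "continuous_on {0..s} ?\<psi>"
        by (intro continuous_at_imp_continuous_on ballI has_vector_derivative_continuous[OF \<psi>'])
      show "continuous_on {0..s} ?b"
        by (intro continuous_at_imp_continuous_on ballI DERIV_isCont[OF b'])
    qed (use \<psi>' b' IH in \<open>auto simp: has_real_derivative_iff_has_vector_derivative[symmetric]
          simp del: sum.atMost_Suc fact_Suc power_Suc\<close>)
    then show ?thesis unfolding 0 by simp
  qed (use 0 in simp)
qed simp

text \<open>Restriction to the segment from \<open>z\<close> to \<open>zh\<close> turns the tensors
  into one-variable derivatives, and the remainder bound is read at \<open>s = 1\<close>.\<close>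

lemma taylor_error:
  fixes F :: "'a::euclidean_space \<Rightarrow> 'b::real_normed_vector"
  assumes p: "p \<ge> 1" and lip: "order_lipschitz p L F" and diff: "times_differentiable (p - 1) F"
  shows "norm (F zh - taylor F z (p - 1) zh) \<le> L / fact p * norm (zh - z) ^ p"
proof -
  let ?h = "zh - z"
  let ?\<phi> = "\<lambda>i s. iter_deriv F (z + s *\<^sub>R ?h) (replicate i ?h)"
  have line: "((\<lambda>s. z + s *\<^sub>R ?h) has_vector_derivative ?h) (at s)" for s
    by (auto intro!: derivative_eq_intros)
  have "norm (?\<phi> 0 1 - (\<Sum>i\<le>p - 1. (1 ^ i / fact i) *\<^sub>R ?\<phi> i 0))
      \<le> (L * norm ?h ^ p) * 1 ^ Suc (p - 1) / fact (Suc (p - 1))"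
  proof (rule taylor_remainder_bound)
    fix i s assume i: "i < p - 1"
    have "((\<lambda>w. iter_deriv F w (replicate i ?h)) has_derivative
        (\<lambda>h. iter_deriv F (z + s *\<^sub>R ?h) (h # replicate i ?h))) (at (z + s *\<^sub>R ?h))"
      using diff i by (intro times_differentiable_has_derivative) auto
    from vector_derivative_diff_chain_within[OF line has_derivative_at_withinI[OF this]]
    show "(?\<phi> i has_vector_derivative ?\<phi> (Suc i) s) (at s)"
      by (simp add: o_def)
  next
    fix s :: real assume s: "0 \<le> s"
    have "norm (?\<phi> (p - 1) s - ?\<phi> (p - 1) 0)
        \<le> L * norm (z + s *\<^sub>R ?h - (z + 0 *\<^sub>R ?h)) * norm ?h ^ (p - 1)"
      by (rule order_lipschitz_replicate[OF lip diff])
    \<comment> \<open>The directions contribute \<open>p - 1\<close> factors \<open>norm ?h\<close>,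
      the displacement of the base point one more.\<close>
    also have "\<dots> = L * norm ?h ^ p * s"
      using s p by (cases p) auto
    finally show "norm (?\<phi> (p - 1) s - ?\<phi> (p - 1) 0) \<le> L * norm ?h ^ p * s" .
  qed simp
  then show ?thesis
    using p by (simp add: taylor_def atMost_atLeast0)
qed

subsection \<open>Strongly convex-concave functions\<close>

lemma grad_eqI:
  fixes f :: "'a::real_inner \<Rightarrow> real"
  assumes "GDERIV f x :> D"
  shows "grad f x = D"
  unfolding grad_def
proof (rule the_equality[where P = "\<lambda>D. GDERIV f x :> D", OF assms])
  fix D' assume "GDERIV f x :> D'"
  then have "(\<lambda>h. h \<bullet> D') = (\<lambda>h. h \<bullet> D)"
    using assms has_derivative_unique unfolding gderiv_def by blast
  then have "(D' - D) \<bullet> D' = (D' - D) \<bullet> D"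
    by meson
  then have "(D' - D) \<bullet> (D' - D) = 0"
    by (simp only: inner_diff_right)
  then show "D' = D" by simp
qed

lemma GDERIV_frechet_derivative:
  fixes f :: "'a::euclidean_space \<Rightarrow> real"
  assumes "f differentiable (at x)"
  shows "GDERIV f x :> (\<Sum>b\<in>Basis. frechet_derivative f (at x) b *\<^sub>R b)"
proof -
  have "frechet_derivative f (at x) h = h \<bullet> (\<Sum>b\<in>Basis. frechet_derivative f (at x) b *\<^sub>R b)" for h
    by (subst frechet_derivative_basis_expansion[OF assms]) (simp add: inner_sum_right mult.commute)
  then have "frechet_derivative f (at x) = (\<lambda>h. h \<bullet> (\<Sum>b\<in>Basis. frechet_derivative f (at x) b *\<^sub>R b))"
    by (rule ext)
  then show ?thesis
    using assms unfolding gderiv_def frechet_derivative_works by (simp only:)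
qed

lemma GDERIV_grad:
  fixes f :: "'a::euclidean_space \<Rightarrow> real"
  assumes "f differentiable (at x)"
  shows "GDERIV f x :> grad f x"
  using GDERIV_frechet_derivative[OF assms] by (simp only: grad_eqI)

lemma GDERIV_partial:
  fixes g :: "'a::real_inner \<times> 'b::real_inner \<Rightarrow> real"
  assumes "GDERIV g (x, y) :> D"
  shows "GDERIV (\<lambda>x'. g (x', y)) x :> fst D" and "GDERIV (\<lambda>y'. g (x, y')) y :> snd D"
proof -
  have g': "(g has_derivative (\<lambda>h. h \<bullet> D)) (at (x, y))"
    using assms by (simp add: gderiv_def)
  have "((\<lambda>x'. (x', y)) has_derivative (\<lambda>h. (h, 0))) (at x)"
    by (intro has_derivative_Pair derivative_intros)
  from has_derivative_compose[OF this g'] show "GDERIV (\<lambda>x'. g (x', y)) x :> fst D"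
    by (simp add: gderiv_def inner_prod_def)
  have "((\<lambda>y'. (x, y')) has_derivative (\<lambda>h. (0, h))) (at y)"
    by (intro has_derivative_Pair derivative_intros)
  from has_derivative_compose[OF this g'] show "GDERIV (\<lambda>y'. g (x, y')) y :> snd D"
    by (simp add: gderiv_def inner_prod_def)
qed

text \<open>Writes the field as a fixed linear combination of directional derivatives of
  \<open>g\<close>, so that smoothness of \<open>g\<close> passes to the field with the loss of one
  order.\<close>

lemma saddle_field_eq_sum:
  fixes g :: "'a::euclidean_space \<times> 'b::euclidean_space \<Rightarrow> real"
  assumes "g differentiable (at z)"
  shows "saddle_field g z = (\<Sum>b\<in>Basis. frechet_derivative g (at z) b *\<^sub>R (fst b, - snd b))"
proof -
  note G = GDERIV_frechet_derivative[OF assms]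
  have "grad_x g (fst z) (snd z) = fst (\<Sum>b\<in>Basis. frechet_derivative g (at z) b *\<^sub>R b)"
    and "grad_y g (fst z) (snd z) = snd (\<Sum>b\<in>Basis. frechet_derivative g (at z) b *\<^sub>R b)"
    unfolding grad_x_def grad_y_def using G by (auto intro!: grad_eqI GDERIV_partial)
  then show ?thesis
    by (simp add: saddle_field_def prod_eq_iff fst_sum snd_sum sum_negf)
qed

lemma times_differentiable_saddle_field:
  fixes g :: "'a::euclidean_space \<times> 'b::euclidean_space \<Rightarrow> real"
  assumes "times_differentiable p g" and "p \<ge> 1"
  shows "times_differentiable (p - 1) (saddle_field g)"
proof -
  have "times_differentiable (p - 1)
      (\<lambda>z. \<Sum>b\<in>Basis. frechet_derivative g (at z) b *\<^sub>R (fst b, - snd b))"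
    using assms
    by (intro times_differentiable_sum_linear bounded_linear_scaleR_left
        times_differentiable_frechet_derivative) auto
  moreover have "saddle_field g = (\<lambda>z. \<Sum>b\<in>Basis. frechet_derivative g (at z) b *\<^sub>R (fst b, - snd b))"
    using assms(2)
    by (intro ext saddle_field_eq_sum times_differentiable_imp_differentiable[OF assms(1)]) simp
  ultimately show ?thesis by (simp only:)
qed

section \<open>First-order optimality and quadratic lower bounds\<close>

lemma grad_zero_at_minimum:
  fixes f :: "'a::euclidean_space \<Rightarrow> real"
  assumes "f differentiable (at x)" and "\<And>y. f x \<le> f y"
  shows "grad f x = 0"
proof -
  have "(\<lambda>h. h \<bullet> grad f x) = (\<lambda>h. 0)"
    using GDERIV_grad[OF assms(1)] assms(2)
    by (intro has_derivative_local_min[of f _ x]) (auto simp: gderiv_def)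
  then have "grad f x \<bullet> grad f x = 0" by meson
  then show ?thesis by simp
qed

text \<open>On the segment, \<open>f\<close> minus its linear and quadratic model has a nonnegative
  derivative by strong monotonicity of the gradient.\<close>

lemma strongly_convex_lower_bound:
  fixes f :: "'a::euclidean_space \<Rightarrow> real"
  assumes diff: "\<And>x. f differentiable (at x)"
    and mono: "\<And>x y. (grad f x - grad f y) \<bullet> (x - y) \<ge> \<mu> * (norm (x - y))\<^sup>2"
  shows "f x + grad f x \<bullet> (y - x) + \<mu> / 2 * (norm (y - x))\<^sup>2 \<le> f y"
proof -
  let ?h = "y - x"
  let ?\<psi> = "\<lambda>s. f (x + s *\<^sub>R ?h) - s * (grad f x \<bullet> ?h) - \<mu> / 2 * s\<^sup>2 * (norm ?h)\<^sup>2"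
  let ?\<psi>' = "\<lambda>s. grad f (x + s *\<^sub>R ?h) \<bullet> ?h - grad f x \<bullet> ?h - \<mu> * s * (norm ?h)\<^sup>2"
  have D: "(?\<psi> has_real_derivative ?\<psi>' s) (at s)" for s
  proof -
    have "((\<lambda>s. x + s *\<^sub>R ?h) has_derivative (\<lambda>r. r *\<^sub>R ?h)) (at s)"
      by (auto intro!: derivative_eq_intros)
    from has_derivative_compose[OF this GDERIV_grad[OF diff, unfolded gderiv_def]]
    have "((\<lambda>s. f (x + s *\<^sub>R ?h)) has_real_derivative grad f (x + s *\<^sub>R ?h) \<bullet> ?h) (at s)"
      by (rule has_derivative_imp_has_field_derivative) (simp add: inner_commute)
    then show ?thesis
      by (auto intro!: derivative_eq_intros)
  qed
  have pos: "0 \<le> ?\<psi>' s" if "0 \<le> s" for s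
  proof (cases "s = 0")
    case False
    then have s: "s > 0" using that by simp
    \<comment> \<open>The displacement is \<open>s *\<^sub>R ?h\<close>, so monotonicity comes with
      a factor \<open>s\<close> that is divided out at the end; this is why \<open>s = 0\<close> is
      separate.\<close>
    have "\<mu> * (s * norm ?h)\<^sup>2 \<le> s * ((grad f (x + s *\<^sub>R ?h) - grad f x) \<bullet> ?h)"
      using mono[of "x + s *\<^sub>R ?h" x] s by simp
    then have "s * (\<mu> * s * (norm ?h)\<^sup>2) \<le> s * ((grad f (x + s *\<^sub>R ?h) - grad f x) \<bullet> ?h)"
      by (simp add: power2_eq_square mult_ac)
    then show ?thesis
      using s by (simp add: inner_diff_left mult_le_cancel_left)
  qed simp
  have "?\<psi> 0 \<le> ?\<psi> 1"
    by (rule DERIV_nonneg_imp_nondecreasing) (use D pos in \<open>auto intro!: exI\<close>)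
  then show ?thesis by simp
qed

section \<open>Jensen inequalities for weighted means\<close>

lemma weighted_mean_centered:
  fixes v :: "'i \<Rightarrow> 'a::real_vector"
  assumes "(\<Sum>t\<in>I. w t) = W" and "W > 0" and "m = (1 / W) *\<^sub>R (\<Sum>t\<in>I. w t *\<^sub>R v t)"
  shows "(\<Sum>t\<in>I. w t *\<^sub>R (v t - m)) = 0"
proof -
  have "(\<Sum>t\<in>I. w t *\<^sub>R (v t - m)) = (\<Sum>t\<in>I. w t *\<^sub>R v t) - (\<Sum>t\<in>I. w t) *\<^sub>R m"
    by (simp only: scaleR_diff_right sum_subtractf scaleR_sum_left)
  then show ?thesis using assms by simp
qed

text \<open>Jensen's inequality by tangents at the mean: the linear terms sum to zero and can be
  added for free.\<close>

lemma norm_weighted_mean_le: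
  fixes v :: "'i \<Rightarrow> 'a::real_inner"
  assumes W: "(\<Sum>t\<in>I. w t) = W" "W > 0" and w: "\<And>t. t \<in> I \<Longrightarrow> w t \<ge> 0"
    and m: "m = (1 / W) *\<^sub>R (\<Sum>t\<in>I. w t *\<^sub>R v t)"
  shows "W * (norm (m - u))\<^sup>2 \<le> (\<Sum>t\<in>I. w t * (norm (v t - u))\<^sup>2)"
proof -
  note sum = weighted_mean_centered[OF W m]
  have const: "(\<Sum>t\<in>I. w t * c) = W * c" for c
    unfolding W(1)[symmetric] sum_distrib_right ..
  have "W * (norm (m - u))\<^sup>2
      = (\<Sum>t\<in>I. w t * (norm (m - u))\<^sup>2) + 2 * ((\<Sum>t\<in>I. w t *\<^sub>R (v t - m)) \<bullet> (m - u))"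
    unfolding sum const by simp
  also have "\<dots> = (\<Sum>t\<in>I. w t * ((norm (m - u))\<^sup>2 + 2 * ((v t - m) \<bullet> (m - u))))"
    by (simp add: inner_sum_left sum_distrib_left distrib_left sum.distrib mult_ac)
  also have "\<dots> \<le> (\<Sum>t\<in>I. w t * (norm (v t - u))\<^sup>2)"
  proof (intro sum_mono mult_left_mono w)
    fix t
    have "(norm (a + b))\<^sup>2 = (norm a)\<^sup>2 + (norm b)\<^sup>2 + 2 * (a \<bullet> b)" for a b :: 'a
      unfolding power2_norm_eq_inner by (simp add: inner_add inner_commute)
    from this[of "v t - m" "m - u"] show "(norm (m - u))\<^sup>2 + 2 * ((v t - m) \<bullet> (m - u)) \<le> (norm (v t - u))\<^sup>2" by simp
  qed
  finally show ?thesis .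
qed

locale strongly_convex_concave =
  fixes g :: "'a::euclidean_space \<times> 'b::euclidean_space \<Rightarrow> real" and \<mu> :: real
  assumes differentiable: "\<And>z. g differentiable (at z)"
    and strongly_convex: "strongly_convex_x \<mu> g"
    and strongly_concave: "strongly_concave_y \<mu> g"
    and \<mu>_pos: "\<mu> > 0"
begin

lemma partial_differentiable:
  "(\<lambda>x. g (x, y)) differentiable (at x)" "(\<lambda>y. g (x, y)) differentiable (at y)"
  unfolding differentiable_def
  by (rule exI, rule GDERIV_partial[OF GDERIV_grad[OF differentiable], unfolded gderiv_def])+

lemma grad_uminus_y: "grad (\<lambda>y. - g (x, y)) y = - grad_y g x y"
  unfolding grad_y_def using GDERIV_grad[OF partial_differentiable(2)]
  by (intro grad_eqI GDERIV_minus)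

lemma convex_lower_bound:
  "g (x, y) + grad_x g x y \<bullet> (x' - x) + \<mu> / 2 * (norm (x' - x))\<^sup>2 \<le> g (x', y)"
  using strongly_convex unfolding strongly_convex_x_def grad_x_def
  by (intro strongly_convex_lower_bound[OF partial_differentiable(1)]) simp

lemma concave_upper_bound:
  "g (x, y') \<le> g (x, y) + grad_y g x y \<bullet> (y' - y) - \<mu> / 2 * (norm (y' - y))\<^sup>2"
proof -
  have "(\<lambda>y. - g (x, y)) differentiable (at y)" for y
    using partial_differentiable(2) by (rule differentiable_minus)
  moreover have "\<mu> * (norm (y1 - y2))\<^sup>2
      \<le> (grad (\<lambda>y. - g (x, y)) y1 - grad (\<lambda>y. - g (x, y)) y2) \<bullet> (y1 - y2)" for y1 y2
    using strongly_concave unfolding strongly_concave_y_def grad_uminus_y by simp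
  ultimately have "- g (x, y) + grad (\<lambda>y. - g (x, y)) y \<bullet> (y' - y) + \<mu> / 2 * (norm (y' - y))\<^sup>2
      \<le> - g (x, y')"
    by (rule strongly_convex_lower_bound)
  then show ?thesis by (simp add: grad_uminus_y)
qed

lemma norm_prod_sq: "(norm (z - u))\<^sup>2 = (norm (fst z - fst u))\<^sup>2 + (norm (snd z - snd u))\<^sup>2"
  for z u :: "'a \<times> 'b"
  by (simp add: norm_prod_def)

text \<open>The convex bound in \<open>x\<close> and the concave bound in \<open>y\<close> are both
  anchored at \<open>z\<close>; subtracting them cancels \<open>g z\<close> and adds the two
  quadratic terms.\<close>

lemma saddle_field_lower_bound:
  "g (fst z, snd u) - g (fst u, snd z) + \<mu> / 2 * (norm (z - u))\<^sup>2 \<le> saddle_field g z \<bullet> (z - u)"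
proof -
  have "saddle_field g z \<bullet> (z - u)
      = - (grad_x g (fst z) (snd z) \<bullet> (fst u - fst z)) + grad_y g (fst z) (snd z) \<bullet> (snd u - snd z)"
    by (simp add: saddle_field_def inner_prod_def inner_diff_right)
  then show ?thesis
    using convex_lower_bound[of "fst z" "snd z" "fst u"] concave_upper_bound[of "fst z" "snd u" "snd z"]
    by (simp add: norm_prod_sq norm_minus_commute algebra_simps)
qed

text \<open>Both partial gradients vanish at a saddle point, so only the quadratic terms
  remain.\<close>

lemma saddle_point_growth:
  assumes "saddle_point g zs"
  shows "\<mu> / 2 * (norm (z - zs))\<^sup>2 \<le> g (fst z, snd zs) - g (fst zs, snd z)"
proof -
  obtain xs ys where zs: "zs = (xs, ys)" by fastforce
  have "grad_x g xs ys = 0"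
    unfolding grad_x_def using assms partial_differentiable(1)
    by (intro grad_zero_at_minimum) (auto simp: saddle_point_def zs)
  moreover have "grad (\<lambda>y. - g (xs, y)) ys = 0"
    using assms partial_differentiable(2)
    by (intro grad_zero_at_minimum differentiable_minus) (auto simp: saddle_point_def zs)
  ultimately show ?thesis
    using convex_lower_bound[of xs ys "fst z"] concave_upper_bound[of xs "snd z" ys]
    by (simp add: zs norm_prod_sq grad_uminus_y algebra_simps)
qed

lemma gap_weighted_mean_le:
  assumes W: "(\<Sum>t\<in>I. w t) = W" "W > 0" and w: "\<And>t. t \<in> I \<Longrightarrow> w t \<ge> 0"
    and m: "m = (1 / W) *\<^sub>R (\<Sum>t\<in>I. w t *\<^sub>R v t)"
  shows "W * (g (fst m, snd u) - g (fst u, snd m))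
    \<le> (\<Sum>t\<in>I. w t * (g (fst (v t), snd u) - g (fst u, snd (v t))))"
proof -
  \<comment> \<open>The gradient at \<open>m\<close> of the function \<open>v\<close> maps to
    \<open>g (fst v, snd u) - g (fst u, snd v)\<close>, which is convex in \<open>v\<close>. It
    differs from the saddle field, since the other arguments come from \<open>u\<close>.\<close>
  let ?D = "(grad_x g (fst m) (snd u), - grad_y g (fst u) (snd m))"
  note sum = weighted_mean_centered[OF W m]
  have const: "(\<Sum>t\<in>I. w t * c) = W * c" for c
    unfolding W(1)[symmetric] sum_distrib_right ..
  have "W * (g (fst m, snd u) - g (fst u, snd m))
      = (\<Sum>t\<in>I. w t * (g (fst m, snd u) - g (fst u, snd m))) + ?D \<bullet> (\<Sum>t\<in>I. w t *\<^sub>R (v t - m))"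
    unfolding sum const by simp
  also have "\<dots> = (\<Sum>t\<in>I. w t * (g (fst m, snd u) - g (fst u, snd m) + ?D \<bullet> (v t - m)))"
    by (simp add: inner_sum_right distrib_left sum.distrib)
  also have "\<dots> \<le> (\<Sum>t\<in>I. w t * (g (fst (v t), snd u) - g (fst u, snd (v t))))"
  proof (intro sum_mono mult_left_mono w)
    fix t
    have "0 \<le> \<mu> / 2 * (norm (fst (v t) - fst m))\<^sup>2" "0 \<le> \<mu> / 2 * (norm (snd (v t) - snd m))\<^sup>2"
      using \<mu>_pos by auto
    then show "g (fst m, snd u) - g (fst u, snd m) + ?D \<bullet> (v t - m)
        \<le> g (fst (v t), snd u) - g (fst u, snd (v t))"
      using convex_lower_bound[of "fst m" "snd u" "fst (v t)"]
        concave_upper_bound[of "fst u" "snd (v t)" "snd m"]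
      by (simp add: inner_prod_def)
  qed
  finally show ?thesis .
qed

end

lemma duality_gap_le:
  assumes "\<And>u. g (fst z, snd u) - g (fst u, snd z) \<le> B"
  shows "duality_gap g z \<le> B"
proof -
  have "(SUP y'. g (fst z, y')) - B \<le> (INF x'. g (x', snd z))"
  proof (rule cINF_greatest)
    fix x'
    have "g (fst z, y') \<le> B + g (x', snd z)" for y'
      using assms[of "(x', y')"] by simp
    then have "(SUP y'. g (fst z, y')) \<le> B + g (x', snd z)"
      by (intro cSUP_least) auto
    then show "(SUP y'. g (fst z, y')) - B \<le> g (x', snd z)" by simp
  qed simp
  then show ?thesis unfolding duality_gap_def by simp
qed

subsection \<open>One run of the mirror prox method\<close>

text \<open>Completing the square: comparison with the candidate \<open>z - v\<close> leaves half
  the squared distance to it. The implicit condition on \<open>zh\<close> is covered too, because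
  \<open>v\<close> is a fixed vector once \<open>zh\<close> is given.\<close>

lemma is_arg_min_prox:
  fixes v :: "'a::real_inner"
  assumes "is_arg_min (\<lambda>w. v \<bullet> (w - a) + half_sq_dist w z) (\<lambda>_. True) m"
  shows "m = z - v"
proof -
  have "v \<bullet> (m - a) + half_sq_dist m z \<le> v \<bullet> (z - v - a) + half_sq_dist (z - v) z"
    using assms unfolding is_arg_min_def by (simp add: not_less)
  then have "1 / 2 * (norm (m - (z - v)))\<^sup>2 \<le> 0"
    unfolding half_sq_dist_def power2_norm_eq_inner
    by (simp add: inner_diff inner_add inner_commute algebra_simps)
  then show ?thesis by simp
qed

text \<open>If the power vanished, division by zero would make the upper bound on
  \<open>\<gamma>\<close> equal to 0.\<close>

lemma mirror_prox_step_radius_nonzero: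
  assumes "mirror_prox_step F p L z \<gamma> zh z'"
  shows "norm (zh - z) ^ (p - 1) > 0"
proof -
  have "norm (zh - z) ^ (p - 1) \<noteq> 0"
    using assms unfolding mirror_prox_step_def by (metis div_by_0 mult_zero_right not_le)
  then show ?thesis
    using zero_le_power[OF norm_ge_zero, of "zh - z" "p - 1"] by linarith
qed

lemma mirror_prox_step_progress:
  fixes F :: "'a::euclidean_space \<Rightarrow> 'a"
  assumes step: "mirror_prox_step F p L z \<gamma> zh z'" and p: "p \<ge> 1" and L: "L > 0"
    and err: "norm (F zh - taylor F z (p - 1) zh) \<le> L / fact p * norm (zh - z) ^ p"
  shows "\<gamma> * (F zh \<bullet> (zh - u))
    \<le> 1 / 2 * ((norm (z - u))\<^sup>2 - (norm (z' - u))\<^sup>2) - 255 / 512 * (norm (zh - z))\<^sup>2"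
proof -
  let ?\<Phi> = "taylor F z (p - 1) zh" and ?r = "norm (zh - z)"
  have \<gamma>: "\<gamma> > 0" and le: "\<gamma> \<le> fact p / (16 * L * ?r ^ (p - 1))"
    using step unfolding mirror_prox_step_def by auto
  define v where "v = \<gamma> *\<^sub>R ?\<Phi>"
  have zh: "zh = z - v"
    using step unfolding mirror_prox_step_def v_def by (intro is_arg_min_prox[of _ z]) simp
  have z': "z' = z - \<gamma> *\<^sub>R F zh"
    using step unfolding mirror_prox_step_def by (intro is_arg_min_prox[of _ zh]) simp
  have rpos: "?r ^ (p - 1) > 0"
    by (rule mirror_prox_step_radius_nonzero[OF step])
  have "z' - zh = \<gamma> *\<^sub>R (?\<Phi> - F zh)"
    unfolding zh z' scaleR_diff_right v_def[unfolded zh, symmetric] by simp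
  then have "norm (z' - zh) = \<gamma> * norm (F zh - ?\<Phi>)"
    using \<gamma> by (simp add: norm_minus_commute)
  also have "\<dots> \<le> \<gamma> * (L / fact p * ?r ^ p)"
    using err \<gamma> by (intro mult_left_mono) auto
  also have "\<dots> = \<gamma> * (16 * L * ?r ^ (p - 1)) / fact p * (?r / 16)"
    using p by (cases p) auto
  also have "\<dots> \<le> 1 * (?r / 16)"
    using le rpos L by (intro mult_right_mono) (auto simp: pos_le_divide_eq)
  finally have "(norm (z' - zh))\<^sup>2 \<le> (?r / 16)\<^sup>2"
    by (intro power_mono) auto
  \<comment> \<open>The three-point identity of the Euclidean prox step, with
    \<open>\<gamma> *\<^sub>R F zh = z - z'\<close>.\<close>
  moreover have "\<gamma> * (F zh \<bullet> (zh - u))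
      = 1 / 2 * ((norm (z - u))\<^sup>2 - (norm (z' - u))\<^sup>2) + 1 / 2 * ((norm (z' - zh))\<^sup>2 - ?r\<^sup>2)"
  proof -
    have "\<gamma> * (F zh \<bullet> (zh - u)) = (z - z') \<bullet> (zh - u)"
      by (simp add: z')
    also have "\<dots> = 1 / 2 * ((norm (z - u))\<^sup>2 - (norm (z' - u))\<^sup>2) + 1 / 2 * ((norm (z' - zh))\<^sup>2 - ?r\<^sup>2)"
      unfolding power2_norm_eq_inner
      by (simp add: inner_diff inner_commute algebra_simps)
    finally show ?thesis .
  qed
  \<comment> \<open>The constant is 1/2 - 1/2 * (1/16)^2 = 255/512.\<close>
  ultimately show ?thesis
    by (simp add: power_divide)
qed

section \<open>Scalar inequalities and step size sums\<close>

text \<open>The power mean inequality between the exponents \<open>- n\<close> and 2, squared to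
  avoid fractional exponents.\<close>

lemma power_mean_inverse:
  fixes r :: "'i \<Rightarrow> real"
  assumes r: "\<And>t. t \<in> I \<Longrightarrow> r t > 0" and I: "finite I" "I \<noteq> {}"
  shows "real (card I) ^ (n + 2) \<le> (\<Sum>t\<in>I. 1 / r t ^ n)\<^sup>2 * (\<Sum>t\<in>I. (r t)\<^sup>2) ^ n"
proof -
  let ?S = "\<Sum>t\<in>I. (r t)\<^sup>2" and ?T = "real (card I)"
  have S: "?S > 0" using r I by (intro sum_pos zero_less_power) auto
  have T: "?T > 0" using I by (simp add: card_gt_0_iff)
  define m where "m = sqrt (?S / ?T)"
  have m: "m > 0" "m\<^sup>2 = ?S / ?T"
    using S T by (auto simp: m_def)
  \<comment> \<open>\<open>x\<^sup>-\<^sup>n\<close> lies above its tangent at \<open>m\<close> in the variable \<open>x\<^sup>2\<close>\<close>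
  have tangent: "1 / m ^ n * (1 - real n / 2 * ((r t)\<^sup>2 / m\<^sup>2 - 1)) \<le> 1 / r t ^ n" if t: "t \<in> I" for t
  proof -
    let ?y = "r t / m"
    have y: "?y > 0" using r[OF t] m by simp
    have "1 - real n / 2 * (?y\<^sup>2 - 1) \<le> 1 - real n / 2 * ln (?y\<^sup>2)"
      using y by (intro diff_left_mono mult_left_mono ln_le_minus_one) auto
    also have "\<dots> = 1 + - (real n * ln ?y)"
      using y by (simp add: ln_realpow)
    also have "\<dots> \<le> exp (- (real n * ln ?y))"
      by (rule exp_ge_add_one_self)
    also have "\<dots> = 1 / ?y ^ n"
      using y by (simp add: exp_minus exp_of_nat_mult inverse_eq_divide)
    finally have "1 / m ^ n * (1 - real n / 2 * (?y\<^sup>2 - 1)) \<le> 1 / m ^ n * (1 / ?y ^ n)"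
      using m by (intro mult_left_mono) auto
    also have "\<dots> = 1 / r t ^ n"
      using m by (simp add: power_divide)
    finally show ?thesis by (simp add: power_divide)
  qed
  \<comment> \<open>Since \<open>m\<close> is the root mean square of the \<open>r t\<close>, the
    linear corrections cancel in the sum.\<close>
  have "(\<Sum>t\<in>I. 1 / m ^ n * (1 - real n / 2 * ((r t)\<^sup>2 / m\<^sup>2 - 1)))
      = 1 / m ^ n * (?T - real n / 2 * (?S / m\<^sup>2 - ?T))"
    by (simp add: sum_subtractf flip: sum_distrib_left sum_divide_distrib)
  also have "\<dots> = ?T / m ^ n"
    using S T by (simp add: m(2))
  finally have tangent_sum: "(\<Sum>t\<in>I. 1 / m ^ n * (1 - real n / 2 * ((r t)\<^sup>2 / m\<^sup>2 - 1))) = ?T / m ^ n" .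
  have "?T / m ^ n \<le> (\<Sum>t\<in>I. 1 / r t ^ n)"
    unfolding tangent_sum[symmetric] by (intro sum_mono tangent)
  then have "(?T / m ^ n)\<^sup>2 \<le> (\<Sum>t\<in>I. 1 / r t ^ n)\<^sup>2"
    using T m by (intro power_mono) auto
  then have "(?T / m ^ n)\<^sup>2 * ?S ^ n \<le> (\<Sum>t\<in>I. 1 / r t ^ n)\<^sup>2 * ?S ^ n"
    using S by (intro mult_right_mono) auto
  moreover have "(?T / m ^ n)\<^sup>2 * ?S ^ n = ?T ^ (n + 2)"
  proof -
    have "(m ^ n)\<^sup>2 = (?S / ?T) ^ n"
      by (simp add: m(2)[symmetric] power_mult[symmetric] mult.commute)
    then show ?thesis
      using S T by (simp add: power_divide power_add power2_eq_square)
  qed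
  ultimately show ?thesis by simp
qed

text \<open>Young's inequality with the weight chosen so that \<open>d\<^sup>2\<close> gets exactly
  the coefficient \<open>G\<close>; in the gap estimate this term is cancelled by the quadratic term
  of the regret bound.\<close>

lemma weighted_cauchy_sq:
  fixes a d G :: real
  assumes "G > 1"
  shows "(a + d)\<^sup>2 \<le> G / (G - 1) * a\<^sup>2 + G * d\<^sup>2"
proof -
  have "0 \<le> (a - (G - 1) * d)\<^sup>2 / (G - 1)"
    using assms by simp
  also have "\<dots> = G / (G - 1) * a\<^sup>2 + G * d\<^sup>2 - (a + d)\<^sup>2"
    using assms by (simp add: field_simps power2_eq_square)
  finally show ?thesis by simp
qed

text \<open>The factorial absorbs the powers of 256/255 that come from bounding \<open>S\<close> by
  \<open>256 / 255 * \<rho>\<^sup>2\<close>.\<close>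

lemma fact_sq_lower_bound:
  "4 * (256 / 255) ^ n \<le> (fact (n + 2) :: real)\<^sup>2"
proof (induction n)
  case (Suc n)
  have "4 * (256 / 255) ^ Suc n \<le> (256 / 255) * (fact (n + 2) :: real)\<^sup>2"
    using Suc by simp
  also have "\<dots> \<le> (real (Suc n + 2))\<^sup>2 * (fact (n + 2) :: real)\<^sup>2"
  proof (rule mult_right_mono)
    have "(1 + 1)\<^sup>2 \<le> (real (Suc n + 2))\<^sup>2" by (intro power_mono) auto
    then show "256 / 255 \<le> (real (Suc n + 2))\<^sup>2" by simp
  qed simp
  also have "\<dots> = (fact (Suc n + 2) :: real)\<^sup>2"
    by (simp add: power_mult_distrib)
  finally show ?case .
qed (simp add: fact_numeral)

text \<open>
  The contraction estimates of one run in terms of \<open>G = \<mu> \<Gamma>\<^sub>T\<close>, \<open>S = \<Sum> \<parallel>\<hat>z\<^sub>t - z\<^sub>t\<parallel>\<^sup>2\<close> and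
  \<open>b = \<parallel>zbar - z\<^sup>*\<parallel>\<close>. For \<open>p \<ge> 2\<close> a small \<open>S\<close> makes \<open>G\<close> large, and a large \<open>S\<close> makes \<open>b\<close> small
  through the negative term; using both is what yields the constant 1/4.
\<close>

lemma run_constants:
  fixes G S b \<rho> :: real
  assumes G: "G > 0" and S: "S \<ge> 0" and b: "b \<ge> 0" and \<rho>: "\<rho> > 0" and p: "p \<ge> 1"
    and contr: "G * b\<^sup>2 \<le> 1 / 2 * \<rho>\<^sup>2 - 255 / 512 * S"
    and growth: "(2 * fact p)\<^sup>2 * (\<rho>\<^sup>2) ^ (p - 1) \<le> G\<^sup>2 * S ^ (p - 1)"
  shows "b \<le> \<rho> / 2" and "G > 1"
    and "(\<rho> + b)\<^sup>2 \<le> (if p = 1 then 9 / 8 else 1 / 4) * \<rho>\<^sup>2 * (2 * (G - 1))"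
proof -
  have "b \<le> \<rho> / 2 \<and> G > 1
      \<and> (\<rho> + b)\<^sup>2 \<le> (if p = 1 then 9 / 8 else 1 / 4) * \<rho>\<^sup>2 * (2 * (G - 1))"
  proof (cases "p = 1")
    case True
    have "2\<^sup>2 \<le> G\<^sup>2" using growth True by simp
    then have G2: "2 \<le> G" by (rule power2_le_imp_le) (use G in simp)
    have "2 * b\<^sup>2 \<le> G * b\<^sup>2" using G2 by (intro mult_right_mono) auto
    then have "b\<^sup>2 \<le> (\<rho> / 2)\<^sup>2" using contr S by (simp add: power_divide)
    then have b2: "b \<le> \<rho> / 2" by (rule power2_le_imp_le) (use \<rho> in simp)
    have "(\<rho> + b)\<^sup>2 \<le> (3 / 2 * \<rho>)\<^sup>2" using b2 b \<rho> by (intro power_mono) auto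
    also have "\<dots> = 9 / 8 * \<rho>\<^sup>2 * 2" by (simp add: power_divide power_mult_distrib)
    also have "\<dots> \<le> 9 / 8 * \<rho>\<^sup>2 * (2 * (G - 1))" using G2 by (intro mult_left_mono) auto
    finally show ?thesis using b2 G2 True by simp
  next
    case False
    define n where "n = p - 2"
    then have n: "p = n + 2" using p False by simp
    have contr0: "0 \<le> G * b\<^sup>2" using G by simp
    have S_le: "S \<le> 256 / 255 * \<rho>\<^sup>2" using contr contr0 by simp
    \<comment> \<open>One factor \<open>S\<close> is kept and the other \<open>n\<close> are bounded
      by \<open>S_le\<close>, which reduces every order to an inequality of the shape for
      \<open>p = 2\<close>.\<close>
    have "16 * \<rho>\<^sup>2 * ((256 / 255) ^ n * (\<rho>\<^sup>2) ^ n) = 4 * (4 * (256 / 255) ^ n) * (\<rho>\<^sup>2) ^ (p - 1)"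
      by (simp add: n)
    also have "\<dots> \<le> 4 * (fact p)\<^sup>2 * (\<rho>\<^sup>2) ^ (p - 1)"
      unfolding n by (intro mult_right_mono mult_left_mono fact_sq_lower_bound) auto
    also have "\<dots> \<le> G\<^sup>2 * S * S ^ n"
      using growth by (simp add: n power_mult_distrib mult.assoc)
    also have "\<dots> \<le> G\<^sup>2 * S * ((256 / 255) ^ n * (\<rho>\<^sup>2) ^ n)"
      unfolding power_mult_distrib[symmetric] using S S_le G
      by (intro mult_left_mono power_mono) auto
    finally have key: "16 * \<rho>\<^sup>2 \<le> G\<^sup>2 * S"
      using \<rho> by (simp add: mult_le_cancel_right)
    have "16 * \<rho>\<^sup>2 \<le> (256 / 255 * G\<^sup>2) * \<rho>\<^sup>2"
      using key mult_left_mono[OF S_le, of "G\<^sup>2"] by (simp add: mult_ac)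
    then have "16 \<le> 256 / 255 * G\<^sup>2" using \<rho> by (simp add: mult_le_cancel_right)
    then have "(399 / 100)\<^sup>2 \<le> G\<^sup>2" by (simp add: power2_eq_square)
    then have G4: "399 / 100 \<le> G" by (rule power2_le_imp_le) (use G in simp)
    \<comment> \<open>The fraction of the budget \<open>1 / 2 * \<rho>\<^sup>2\<close> spent on
      \<open>S\<close>; the part left for \<open>G * b\<^sup>2\<close> is
      \<open>1 - \<sigma>\<close>.\<close>
    define \<sigma> where "\<sigma> = 255 / 256 * S / \<rho>\<^sup>2"
    have \<sigma>: "0 \<le> \<sigma>" "\<sigma> \<le> 1" "S = 256 / 255 * \<sigma> * \<rho>\<^sup>2"
      using S S_le \<rho> by (auto simp: \<sigma>_def field_simps)
    have cubic: "\<sigma> * (1 - \<sigma>)\<^sup>2 \<le> 4 / 27"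
    proof -
      \<comment> \<open>The cubic attains its maximum over [0, 1] at 1/3, hence the double
        root.\<close>
      have "0 \<le> (1 / 3 - \<sigma>)\<^sup>2 * (4 / 3 - \<sigma>)" using \<sigma> by simp
      also have "\<dots> = 4 / 27 - \<sigma> * (1 - \<sigma>)\<^sup>2" by (simp add: power2_eq_square field_simps)
      finally show ?thesis by simp
    qed
    \<comment> \<open>Multiplying by the fourth power of \<open>b\<close> turns the unknown
      \<open>G\<close> into \<open>G * b\<^sup>2\<close>, which \<open>contr\<close>
      controls.\<close>
    have "16 * \<rho>\<^sup>2 * (b\<^sup>2)\<^sup>2 \<le> G\<^sup>2 * S * (b\<^sup>2)\<^sup>2"
      using key by (intro mult_right_mono) auto
    also have "\<dots> = (G * b\<^sup>2)\<^sup>2 * S" by (simp add: power_mult_distrib)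
    also have "\<dots> \<le> (1 / 2 * \<rho>\<^sup>2 * (1 - \<sigma>))\<^sup>2 * S"
      using contr contr0 S \<sigma>(3) by (intro mult_right_mono power_mono) (auto simp: algebra_simps)
    also have "\<dots> = (64 / 255 * (\<rho>\<^sup>2)\<^sup>2 * \<rho>\<^sup>2) * (\<sigma> * (1 - \<sigma>)\<^sup>2)"
      unfolding \<sigma>(3) by (simp add: power_mult_distrib power_divide)
    also have "\<dots> \<le> (64 / 255 * (\<rho>\<^sup>2)\<^sup>2 * \<rho>\<^sup>2) * (4 / 27)"
      by (intro mult_left_mono cubic) auto
    finally have "16 * (b\<^sup>2)\<^sup>2 * \<rho>\<^sup>2 \<le> 256 / 6885 * (\<rho>\<^sup>2)\<^sup>2 * \<rho>\<^sup>2" by simp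
    then have "16 * (b\<^sup>2)\<^sup>2 \<le> 256 / 6885 * (\<rho>\<^sup>2)\<^sup>2" using \<rho> by (simp add: mult_le_cancel_right)
    also have "\<dots> \<le> 16 * ((11 / 50)\<^sup>2 * \<rho>\<^sup>2)\<^sup>2"
      by (simp add: power_mult_distrib power_divide)
    finally have "(b\<^sup>2)\<^sup>2 \<le> ((11 / 50)\<^sup>2 * \<rho>\<^sup>2)\<^sup>2" by simp
    then have "b\<^sup>2 \<le> (11 / 50)\<^sup>2 * \<rho>\<^sup>2" by (rule power2_le_imp_le) simp
    then have "b\<^sup>2 \<le> (11 / 50 * \<rho>)\<^sup>2" by (simp only: power_mult_distrib)
    then have b2: "b \<le> 11 / 50 * \<rho>" by (rule power2_le_imp_le) (use \<rho> in simp)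
    have "(\<rho> + b)\<^sup>2 \<le> (61 / 50 * \<rho>)\<^sup>2" using b2 b \<rho> by (intro power_mono) auto
    also have "\<dots> \<le> 1 / 4 * \<rho>\<^sup>2 * (2 * (399 / 100 - 1))"
      by (simp add: power_mult_distrib power_divide)
    also have "\<dots> \<le> 1 / 4 * \<rho>\<^sup>2 * (2 * (G - 1))" using G4 by (intro mult_left_mono) auto
    finally show ?thesis using b2 \<rho> G4 False by simp
  qed
  then show "b \<le> \<rho> / 2" and "G > 1"
    and "(\<rho> + b)\<^sup>2 \<le> (if p = 1 then 9 / 8 else 1 / 4) * \<rho>\<^sup>2 * (2 * (G - 1))"
    by auto
qed

text \<open>Combines the lower bound on each step size with the power mean inequality for
  \<open>n = p - 1\<close>. For \<open>p = 1\<close> radii may be zero, but then they do not enter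
  the bound.\<close>

lemma mirror_prox_step_size_sum:
  fixes F :: "'a::euclidean_space \<Rightarrow> 'a"
  assumes step: "\<And>t. t \<in> {1..T} \<Longrightarrow> mirror_prox_step F p L (z t) (\<gamma> t) (zh t) (z' t)"
    and p: "p \<ge> 1" and L: "L > 0" and T: "T \<ge> 1" and X: "X > 0" "X\<^sup>2 \<le> real T ^ (p + 1)"
  shows "(fact p / (32 * L) * X)\<^sup>2 \<le> (\<Sum>t=1..T. \<gamma> t)\<^sup>2 * (\<Sum>t=1..T. (norm (zh t - z t))\<^sup>2) ^ (p - 1)"
proof -
  let ?r = "\<lambda>t. norm (zh t - z t)" and ?n = "p - 1"
  let ?S = "\<Sum>t=1..T. (?r t)\<^sup>2" and ?I = "\<Sum>t=1..T. 1 / ?r t ^ ?n"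
  have pm: "real T ^ (p + 1) \<le> ?I\<^sup>2 * ?S ^ ?n"
  proof (cases "p = 1")
    case False
    have "?r t > 0" if "t \<in> {1..T}" for t
      using mirror_prox_step_radius_nonzero[OF step[OF that]] False p
      by (cases "zh t = z t") (auto simp: zero_power)
    from power_mean_inverse[of "{1..T}" ?r, OF this, of ?n] show ?thesis
      using T p by simp
  qed (simp add: power2_eq_square)
  have "fact p / (32 * L) * ?I \<le> (\<Sum>t=1..T. \<gamma> t)"
    unfolding sum_distrib_left
    using step by (intro sum_mono) (auto simp: mirror_prox_step_def)
  moreover have "0 \<le> fact p / (32 * L) * ?I"
    using L by (intro mult_nonneg_nonneg sum_nonneg) auto
  ultimately have "(fact p / (32 * L) * ?I)\<^sup>2 \<le> (\<Sum>t=1..T. \<gamma> t)\<^sup>2"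
    by (rule power_mono)
  then have "(fact p / (32 * L) * ?I)\<^sup>2 * ?S ^ ?n \<le> (\<Sum>t=1..T. \<gamma> t)\<^sup>2 * ?S ^ ?n"
    by (rule mult_right_mono) (auto intro!: zero_le_power sum_nonneg)
  moreover have "(fact p / (32 * L) * X)\<^sup>2 \<le> (fact p / (32 * L) * ?I)\<^sup>2 * ?S ^ ?n"
  proof -
    have "(fact p / (32 * L))\<^sup>2 * X\<^sup>2 \<le> (fact p / (32 * L))\<^sup>2 * (?I\<^sup>2 * ?S ^ ?n)"
      using X(2) pm by (intro mult_left_mono) auto
    then show ?thesis by (simp only: power_mult_distrib mult.assoc)
  qed
  ultimately show ?thesis by linarith
qed

section \<open>Regret, contraction and duality gap of a run\<close>

context strongly_convex_concave
begin

text \<open>Jensen moves from \<open>zbar\<close> to the points \<open>zh t\<close>, strong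
  convexity-concavity brings in the field, and the one-step estimates telescope. The quadratic term
  is kept for later cancellation.\<close>

lemma mirror_prox_regret:
  assumes step: "\<And>t. t \<in> {1..T} \<Longrightarrow> mirror_prox_step (saddle_field g) p L (z t) (\<gamma> t) (zh t) (z (Suc t))"
    and p: "p \<ge> 1" and L: "L > 0" and T: "T \<ge> 1"
    and err: "\<And>z zh. norm (saddle_field g zh - taylor (saddle_field g) z (p - 1) zh)
        \<le> L / fact p * norm (zh - z) ^ p"
    and \<Gamma>: "\<Gamma> = (\<Sum>t=1..T. \<gamma> t)"
    and zbar: "zbar = (1 / \<Gamma>) *\<^sub>R (\<Sum>t=1..T. \<gamma> t *\<^sub>R zh t)"
  shows "\<Gamma> > 0"
    and "\<Gamma> * (g (fst zbar, snd u) - g (fst u, snd zbar) + \<mu> / 2 * (norm (zbar - u))\<^sup>2)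
      \<le> 1 / 2 * (norm (z 1 - u))\<^sup>2 - 255 / 512 * (\<Sum>t=1..T. (norm (zh t - z t))\<^sup>2)"
proof -
  let ?I = "{1..T}" and ?gap = "\<lambda>v. g (fst v, snd u) - g (fst u, snd v)"
  have \<gamma>: "\<gamma> t > 0" if "t \<in> ?I" for t
    using step[OF that] by (simp add: mirror_prox_step_def)
  show \<Gamma>_pos: "\<Gamma> > 0"
    unfolding \<Gamma> using T by (intro sum_pos \<gamma>) auto
  note mean = \<Gamma>[symmetric] \<Gamma>_pos less_imp_le[OF \<gamma>] zbar
  have "\<Gamma> * (?gap zbar + \<mu> / 2 * (norm (zbar - u))\<^sup>2)
      = \<Gamma> * ?gap zbar + \<mu> / 2 * (\<Gamma> * (norm (zbar - u))\<^sup>2)"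
    by (simp add: algebra_simps)
  also have "\<dots> \<le> (\<Sum>t\<in>?I. \<gamma> t * ?gap (zh t)) + \<mu> / 2 * (\<Sum>t\<in>?I. \<gamma> t * (norm (zh t - u))\<^sup>2)"
    using gap_weighted_mean_le[OF mean] norm_weighted_mean_le[OF mean] \<mu>_pos
    by (intro add_mono mult_left_mono) auto
  also have "\<dots> = (\<Sum>t\<in>?I. \<gamma> t * (?gap (zh t) + \<mu> / 2 * (norm (zh t - u))\<^sup>2))"
    by (simp add: sum_distrib_left distrib_left sum.distrib mult_ac)
  also have "\<dots> \<le> (\<Sum>t\<in>?I. \<gamma> t * (saddle_field g (zh t) \<bullet> (zh t - u)))"
    using less_imp_le[OF \<gamma>] by (intro sum_mono mult_left_mono saddle_field_lower_bound)
  also have "\<dots> \<le> (\<Sum>t\<in>?I. 1 / 2 * ((norm (z t - u))\<^sup>2 - (norm (z (Suc t) - u))\<^sup>2)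
      - 255 / 512 * (norm (zh t - z t))\<^sup>2)"
    by (intro sum_mono mirror_prox_step_progress[OF step p L err])
  also have "\<dots> = 1 / 2 * (\<Sum>t\<in>?I. (norm (z t - u))\<^sup>2 - (norm (z (Suc t) - u))\<^sup>2)
      - 255 / 512 * (\<Sum>t\<in>?I. (norm (zh t - z t))\<^sup>2)"
    unfolding sum_distrib_left by (rule sum_subtractf)
  also have "(\<Sum>t\<in>?I. (norm (z t - u))\<^sup>2 - (norm (z (Suc t) - u))\<^sup>2)
      = (norm (z 1 - u))\<^sup>2 - (norm (z (Suc T) - u))\<^sup>2"
    using T by (induction T rule: dec_induct) simp_all
  finally show "\<Gamma> * (?gap zbar + \<mu> / 2 * (norm (zbar - u))\<^sup>2)
      \<le> 1 / 2 * (norm (z 1 - u))\<^sup>2 - 255 / 512 * (\<Sum>t\<in>?I. (norm (zh t - z t))\<^sup>2)"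
    using zero_le_power2[of "norm (z (Suc T) - u)"] unfolding right_diff_distrib by linarith
qed

lemma mirror_prox_run:
  assumes out: "mirror_prox_output (saddle_field g) p L T z1 zbar"
    and p: "p \<ge> 1" and L: "L > 0" and T: "T \<ge> 1"
    and err: "\<And>z zh. norm (saddle_field g zh - taylor (saddle_field g) z (p - 1) zh)
        \<le> L / fact p * norm (zh - z) ^ p"
    and zs: "saddle_point g zs" and \<rho>: "\<rho> > 0" "norm (z1 - zs) \<le> \<rho>"
    and iter: "(64 * L * \<rho> ^ (p - 1) / \<mu>)\<^sup>2 \<le> real T ^ (p + 1)"
  shows "norm (zbar - zs) \<le> \<rho> / 2"
    and "duality_gap g zbar \<le> (if p = 1 then 9 / 8 else 1 / 4) * \<mu> * \<rho>\<^sup>2"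
proof -
  obtain z \<gamma> zh where z1: "z 1 = z1"
    and step: "\<And>t. t \<in> {1..T} \<Longrightarrow> mirror_prox_step (saddle_field g) p L (z t) (\<gamma> t) (zh t) (z (Suc t))"
    and zbar: "zbar = (1 / (\<Sum>t=1..T. \<gamma> t)) *\<^sub>R (\<Sum>t=1..T. \<gamma> t *\<^sub>R zh t)"
    using out unfolding mirror_prox_output_def by blast
  define \<Gamma> where "\<Gamma> = (\<Sum>t=1..T. \<gamma> t)"
  define S where "S = (\<Sum>t=1..T. (norm (zh t - z t))\<^sup>2)"
  have \<Gamma>: "\<Gamma> > 0"
    and regret: "\<And>u. \<Gamma> * (g (fst zbar, snd u) - g (fst u, snd zbar) + \<mu> / 2 * (norm (zbar - u))\<^sup>2)
      \<le> 1 / 2 * (norm (z1 - u))\<^sup>2 - 255 / 512 * S"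
    using mirror_prox_regret[where z = z and zh = zh, OF step p L T err \<Gamma>_def zbar[folded \<Gamma>_def]]
    unfolding S_def z1 by blast+
  let ?G = "\<mu> * \<Gamma>" and ?b = "norm (zbar - zs)" and ?c = "if p = 1 then 9 / 8 else 1 / 4 :: real"
  have G: "?G > 0" using \<Gamma> \<mu>_pos by simp
  have S: "S \<ge> 0" unfolding S_def by (intro sum_nonneg) auto
  \<comment> \<open>Half of the coefficient comes from the regret bound, the other half from the
    growth of the gap at the saddle point.\<close>
  have "?G * ?b\<^sup>2 = \<Gamma> * (\<mu> / 2 * ?b\<^sup>2 + \<mu> / 2 * ?b\<^sup>2)" by simp
  also have "\<dots> \<le> \<Gamma> * (g (fst zbar, snd zs) - g (fst zs, snd zbar) + \<mu> / 2 * ?b\<^sup>2)"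
    using saddle_point_growth[OF zs, of zbar] \<Gamma> by (intro mult_left_mono) auto
  also have "\<dots> \<le> 1 / 2 * (norm (z1 - zs))\<^sup>2 - 255 / 512 * S"
    by (rule regret)
  also have "\<dots> \<le> 1 / 2 * \<rho>\<^sup>2 - 255 / 512 * S"
    using \<rho> by (intro diff_right_mono mult_left_mono power_mono) auto
  finally have contr: "?G * ?b\<^sup>2 \<le> 1 / 2 * \<rho>\<^sup>2 - 255 / 512 * S" .
  have growth: "(2 * fact p)\<^sup>2 * (\<rho>\<^sup>2) ^ (p - 1) \<le> ?G\<^sup>2 * S ^ (p - 1)"
  proof -
    have "64 * L * \<rho> ^ (p - 1) / \<mu> > 0" using L \<rho> \<mu>_pos by simp
    from mirror_prox_step_size_sum[OF step p L T this iter]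
    have "(fact p / (32 * L) * (64 * L * \<rho> ^ (p - 1) / \<mu>))\<^sup>2 \<le> \<Gamma>\<^sup>2 * S ^ (p - 1)"
      unfolding \<Gamma>_def S_def .
    then have "\<mu>\<^sup>2 * (fact p / (32 * L) * (64 * L * \<rho> ^ (p - 1) / \<mu>))\<^sup>2 \<le> \<mu>\<^sup>2 * (\<Gamma>\<^sup>2 * S ^ (p - 1))"
      by (rule mult_left_mono) simp
    moreover have "\<mu> * (fact p / (32 * L) * (64 * L * \<rho> ^ (p - 1) / \<mu>)) = 2 * fact p * \<rho> ^ (p - 1)"
      using L \<mu>_pos by simp
    then have "\<mu>\<^sup>2 * (fact p / (32 * L) * (64 * L * \<rho> ^ (p - 1) / \<mu>))\<^sup>2
        = (2 * fact p * \<rho> ^ (p - 1))\<^sup>2"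
      by (simp only: power_mult_distrib[symmetric])
    moreover have "(\<rho> ^ (p - 1))\<^sup>2 = (\<rho>\<^sup>2) ^ (p - 1)"
      by (simp add: power_mult[symmetric] mult.commute)
    ultimately show ?thesis by (simp add: power_mult_distrib mult.assoc)
  qed
  note const = run_constants[OF G S norm_ge_zero \<rho>(1) p contr growth]
  show "?b \<le> \<rho> / 2" by (rule const(1))
  have cancel: "H / (H - 1) * (x * (2 * (H - 1))) = 2 * H * x" if "H > 1" for H x :: real
    using that by (simp add: field_simps)
  show "duality_gap g zbar \<le> ?c * \<mu> * \<rho>\<^sup>2"
  proof (rule duality_gap_le)
    fix u
    let ?gap = "g (fst zbar, snd u) - g (fst u, snd zbar)" and ?d = "norm (zbar - u)"
    \<comment> \<open>The detour through \<open>zs\<close> and \<open>zbar\<close> leaves the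
      distance from \<open>zbar\<close> to \<open>u\<close> as the only unbounded term.\<close>
    have "norm (z1 - u) \<le> norm (z1 - zs) + norm (zs - zbar) + norm (zbar - u)"
      using norm_triangle_ineq[of "z1 - zs" "zs - u"] norm_triangle_ineq[of "zs - zbar" "zbar - u"] by simp
    then have "norm (z1 - u) \<le> (\<rho> + ?b) + ?d"
      using \<rho>(2) by (simp add: norm_minus_commute)
    then have "(norm (z1 - u))\<^sup>2 \<le> ((\<rho> + ?b) + ?d)\<^sup>2"
      by (intro power_mono) auto
    also have "\<dots> \<le> ?G / (?G - 1) * (\<rho> + ?b)\<^sup>2 + ?G * ?d\<^sup>2"
      by (rule weighted_cauchy_sq[OF const(2)])
    also have "?G / (?G - 1) * (\<rho> + ?b)\<^sup>2 \<le> ?G / (?G - 1) * (?c * \<rho>\<^sup>2 * (2 * (?G - 1)))"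
      using const(2) by (intro mult_left_mono const(3)) auto
    also have "\<dots> = 2 * ?G * (?c * \<rho>\<^sup>2)"
      by (rule cancel[OF const(2)])
    finally have "\<Gamma> * (?gap + \<mu> / 2 * ?d\<^sup>2) \<le> 1 / 2 * (2 * ?G * (?c * \<rho>\<^sup>2) + ?G * ?d\<^sup>2)"
      using regret[of u] S by simp
    also have "\<dots> = \<Gamma> * (?c * \<mu> * \<rho>\<^sup>2 + \<mu> / 2 * ?d\<^sup>2)"
      by (simp add: algebra_simps)
    finally show "?gap \<le> ?c * \<mu> * \<rho>\<^sup>2"
      using \<Gamma> by (simp add: mult_le_cancel_left)
  qed
qed

end

subsection \<open>Restarts\<close>

text \<open>Turns the real exponent in the choice of the iteration number into the integer power
  required by \<open>mirror_prox_run\<close>.\<close>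

lemma inner_iterations_lower_bound:
  assumes "\<mu> > 0" "L > 0" "R > 0"
  shows "inner_iterations p L \<mu> R i \<ge> 1"
    and "(64 * L * restart_radius R i ^ (p - 1) / \<mu>)\<^sup>2 \<le> real (inner_iterations p L \<mu> R i) ^ (p + 1)"
proof -
  let ?X = "64 * L * restart_radius R i ^ (p - 1) / \<mu>"
  let ?q = "2 / (real p + 1)"
  have X: "?X > 0" using assms by (simp add: restart_radius_def)
  then have Xq: "?X powr ?q > 0" unfolding powr_gt_zero by linarith
  then show "inner_iterations p L \<mu> R i \<ge> 1"
    unfolding inner_iterations_def by linarith
  have "(?X powr ?q) ^ (p + 1) = ?X powr (?q * real (p + 1))"
    by (simp only: powr_realpow[OF Xq, symmetric] powr_powr)
  also have "?q * real (p + 1) = real 2" by (simp add: field_simps)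
  also have "?X powr real 2 = ?X\<^sup>2" by (rule powr_realpow[OF X])
  finally have "?X\<^sup>2 = (?X powr ?q) ^ (p + 1)" ..
  also have "\<dots> \<le> real (inner_iterations p L \<mu> R i) ^ (p + 1)"
    unfolding inner_iterations_def using Xq by (intro power_mono real_nat_ceiling_ge) auto
  finally show "?X\<^sup>2 \<le> real (inner_iterations p L \<mu> R i) ^ (p + 1)" .
qed

text \<open>The exponent is at most 1, so 64 stays at most 64 under it, and the ceiling adds at most
  1.\<close>

lemma inner_iterations_upper_bound:
  assumes "\<mu> > 0" "L > 0" "R > 0" "p \<ge> 1"
  shows "real (inner_iterations p L \<mu> R i) \<le> 65 * max 1 ((L * R ^ (p - 1) / \<mu>) powr (2 / (real p + 1)))"
proof -
  let ?X = "64 * L * restart_radius R i ^ (p - 1) / \<mu>" and ?Y = "L * R ^ (p - 1) / \<mu>"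
  let ?q = "2 / (real p + 1)"
  have Y: "?Y > 0" using assms by simp
  have "restart_radius R i \<le> R"
    using assms(3) by (simp add: restart_radius_def divide_le_eq mult_ge1_I)
  then have "restart_radius R i ^ (p - 1) \<le> R ^ (p - 1)"
    using assms(3) by (intro power_mono) (auto simp: restart_radius_def)
  then have "?X \<le> 64 * ?Y"
    using assms by (simp add: divide_right_mono)
  then have "?X powr ?q \<le> (64 * ?Y) powr ?q"
    using assms by (intro powr_mono2) (auto simp: restart_radius_def)
  also have "\<dots> = 64 powr ?q * ?Y powr ?q"
    by (rule powr_mult)
  also have "\<dots> \<le> 64 powr 1 * ?Y powr ?q"
    using assms(4) by (intro mult_right_mono powr_mono) auto
  finally have "?X powr ?q \<le> 64 * max 1 (?Y powr ?q)" by (simp add: max_def)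
  moreover have "real (inner_iterations p L \<mu> R i) \<le> ?X powr ?q + 1"
    unfolding inner_iterations_def by (simp add: of_nat_ceiling)
  ultimately show ?thesis by (simp add: max_def split: if_splits)
qed

text \<open>Half the binary logarithm is the logarithm to base 4, matching the factor 4 gained in
  the squared radius per restart.\<close>

lemma num_restarts_bounds:
  assumes "0 < \<epsilon>" "\<epsilon> < \<mu> * R\<^sup>2"
  shows "num_restarts \<mu> R \<epsilon> \<ge> 1"
    and "\<mu> * R\<^sup>2 / \<epsilon> \<le> 4 ^ num_restarts \<mu> R \<epsilon>"
    and "real (num_restarts \<mu> R \<epsilon>) \<le> 1 / 2 * log 2 (\<mu> * R\<^sup>2 / \<epsilon>) + 1"
proof -
  let ?Q = "\<mu> * R\<^sup>2 / \<epsilon>" and ?k = "num_restarts \<mu> R \<epsilon>"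
  have Q: "?Q > 1" using assms by simp
  then have log: "log 2 ?Q > 0" by simp
  then show "?k \<ge> 1" unfolding num_restarts_def by linarith
  show "real ?k \<le> 1 / 2 * log 2 ?Q + 1"
    unfolding num_restarts_def using log by linarith
  have "1 / 2 * log 2 ?Q \<le> real ?k" unfolding num_restarts_def by (rule real_nat_ceiling_ge)
  then have "log 2 ?Q \<le> real (2 * ?k)" by simp
  then have "?Q \<le> 2 powr real (2 * ?k)"
    using Q by (subst (asm) log_le_iff) auto
  also have "\<dots> = 4 ^ ?k" unfolding powr_realpow[OF zero_less_numeral] by (simp add: power_mult)
  finally show "?Q \<le> 4 ^ ?k" .
qed

lemma total_iterations_upper_bound:
  assumes "p \<ge> 1" "\<mu> > 0" "L > 0" "R > 0" "0 < \<epsilon>" "\<epsilon> < \<mu> * R\<^sup>2"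
  shows "real (total_iterations p L \<mu> R (run_accuracy p \<epsilon>))
      \<le> 200 * max 1 ((L * R ^ (p - 1) / \<mu>) powr (2 / (real p + 1)))
            * max 1 (log 2 (\<mu> * R\<^sup>2 / \<epsilon>))"
proof -
  let ?\<delta> = "run_accuracy p \<epsilon>" and ?l = "log 2 (\<mu> * R\<^sup>2 / \<epsilon>)"
  let ?A = "max 1 ((L * R ^ (p - 1) / \<mu>) powr (2 / (real p + 1)))"
  have \<delta>: "0 < ?\<delta>" "?\<delta> < \<mu> * R\<^sup>2"
    using assms by (auto simp: run_accuracy_def)
  have Q: "\<mu> * R\<^sup>2 / \<epsilon> > 0" "\<mu> * R\<^sup>2 / ?\<delta> > 0" using assms \<delta> by auto
  have "\<mu> * R\<^sup>2 / ?\<delta> = (if p = 1 then 5 else 1) * (\<mu> * R\<^sup>2 / \<epsilon>)"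
    by (simp add: run_accuracy_def)
  also have "\<dots> \<le> 8 * (\<mu> * R\<^sup>2 / \<epsilon>)"
    using Q(1) by (intro mult_right_mono) auto
  finally have \<delta>': "\<mu> * R\<^sup>2 / ?\<delta> \<le> 8 * (\<mu> * R\<^sup>2 / \<epsilon>)" .
  \<comment> \<open>The factor 5 in \<open>run_accuracy\<close> is rounded up to 8, which adds 3 to
    the logarithm. Then l/2 + 5/2 is at most 3 max(1, l), and 3 * 65 = 195 gives the final
    200.\<close>
  have "log 2 (\<mu> * R\<^sup>2 / ?\<delta>) \<le> log 2 (2 ^ 3 * (\<mu> * R\<^sup>2 / \<epsilon>))"
    using \<delta>' Q by simp
  also have "\<dots> = log 2 (2 ^ 3) + ?l"
    using Q by (intro log_mult_pos) auto
  also have "log 2 (2 ^ 3) = (3 :: real)" by (subst log_nat_power) auto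
  finally have "real (num_restarts \<mu> R ?\<delta>) \<le> 3 * max 1 ?l"
    using num_restarts_bounds(3)[OF \<delta>] by simp
  moreover have "real (total_iterations p L \<mu> R ?\<delta>) \<le> real (num_restarts \<mu> R ?\<delta>) * (65 * ?A)"
    unfolding total_iterations_def of_nat_sum
    using inner_iterations_upper_bound[OF assms(2-4,1)]
    by (intro order_trans[OF sum_bounded_above[of _ _ "65 * ?A"]]) auto
  ultimately have "real (total_iterations p L \<mu> R ?\<delta>) \<le> (3 * max 1 ?l) * (65 * ?A)"
    by (meson mult_right_mono order_trans le_max_iff_disj zero_le_one zero_le_mult_iff zero_le_numeral)
  also have "\<dots> \<le> 200 * (?A * max 1 ?l)"
    by (simp add: mult_ac)
  finally show ?thesis by (simp add: mult.assoc)
qed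

text \<open>All runs but the last serve only to halve the distance to the saddle point; the gap
  estimate is applied to the last run.\<close>

lemma (in strongly_convex_concave) restarted_output_gap:
  assumes out: "restarted_output (saddle_field g) p L \<mu> R \<delta> z1 z"
    and p: "p \<ge> 1" and L: "L > 0"
    and err: "\<And>z zh. norm (saddle_field g zh - taylor (saddle_field g) z (p - 1) zh)
        \<le> L / fact p * norm (zh - z) ^ p"
    and zs: "saddle_point g zs" and R: "R > 0" "norm (z1 - zs) \<le> R"
    and \<delta>: "0 < \<delta>" "\<delta> < \<mu> * R\<^sup>2"
  shows "duality_gap g z \<le> (if p = 1 then 9 / 2 else 1) * \<delta>"
proof -
  define k where "k = num_restarts \<mu> R \<delta>"
  obtain zt where zt1: "zt 1 = z1" and z: "z = zt (Suc k)"
    and run: "\<And>i. i \<in> {1..k} \<Longrightarrow>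
      mirror_prox_output (saddle_field g) p L (inner_iterations p L \<mu> R i) (zt i) (zt (Suc i))"
    using out unfolding restarted_output_def k_def by blast
  have k: "k \<ge> 1" and k4: "\<mu> * R\<^sup>2 / \<delta> \<le> 4 ^ k"
    using num_restarts_bounds[OF \<delta>] by (simp_all add: k_def)
  have \<rho>: "restart_radius R i > 0" for i using R by (simp add: restart_radius_def)
  note run_step = mirror_prox_run[OF run p L inner_iterations_lower_bound(1)[OF \<mu>_pos L R(1)] err zs \<rho> _
      inner_iterations_lower_bound(2)[OF \<mu>_pos L R(1)]]
  have dist: "norm (zt i - zs) \<le> restart_radius R i" if "1 \<le> i" "i \<le> k" for i
    using that
  proof (induction i rule: dec_induct)
    case (step i)
    have "norm (zt (Suc i) - zs) \<le> restart_radius R i / 2"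
      using step by (intro run_step(1)) auto
    also have "\<dots> = restart_radius R (Suc i)"
      using step by (cases i) (auto simp: restart_radius_def)
    finally show ?case .
  qed (use zt1 R in \<open>simp add: restart_radius_def\<close>)
  have "duality_gap g z \<le> (if p = 1 then 9 / 8 else 1 / 4) * \<mu> * (restart_radius R k)\<^sup>2"
    unfolding z using k by (intro run_step(2) dist) auto
  \<comment> \<open>The last radius is \<open>R / 2 ^ (k - 1)\<close>, so its square is 4 times
    \<open>R\<^sup>2 / 4 ^ k\<close>; the 4 turns 9/8 into 9/2 and 1/4 into 1.\<close>
  also have "\<dots> = (if p = 1 then 9 / 2 else 1) * (\<mu> * R\<^sup>2 / 4 ^ k)"
  proof -
    obtain m where "k = Suc m" using k by (cases k) auto
    moreover have "(2 ^ m)\<^sup>2 = (4 :: real) ^ m"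
      by (simp add: power_mult[symmetric] mult.commute[of m] power_mult)
    ultimately show ?thesis by (simp add: restart_radius_def power_divide)
  qed
  also have "\<dots> \<le> (if p = 1 then 9 / 2 else 1) * \<delta>"
  proof (rule mult_left_mono)
    show "\<mu> * R\<^sup>2 / 4 ^ k \<le> \<delta>"
      using k4 \<delta>(1) by (simp add: divide_le_eq mult.commute)
  qed simp
  finally show ?thesis .
qed

theorem theorem1:
  fixes g :: "(real ^ 'n) \<times> (real ^ 'm) \<Rightarrow> real"
    and p :: nat and \<mu> L R \<epsilon> :: real
    and zstar z1 :: "(real ^ 'n) \<times> (real ^ 'm)"
  assumes "p \<ge> 1" and "\<mu> > 0" and "L > 0"
    and "times_differentiable p g"
    and "strongly_convex_x \<mu> g" and "strongly_concave_y \<mu> g"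
    and "order_lipschitz p L (saddle_field g)"
    and "saddle_point g zstar"
    and "R \<ge> norm (z1 - zstar)"
    and "0 < \<epsilon>" and "\<epsilon> < 1"
    and "\<epsilon> < \<mu> * R\<^sup>2"
  shows "(\<forall>out. restarted_output (saddle_field g) p L \<mu> R (run_accuracy p \<epsilon>) z1 out
        \<longrightarrow> duality_gap g out \<le> \<epsilon>) \<and>
    real (total_iterations p L \<mu> R (run_accuracy p \<epsilon>))
      \<le> 200 * max 1 ((L * R ^ (p - 1) / \<mu>) powr (2 / (real p + 1)))
            * max 1 (log 2 (\<mu> * R\<^sup>2 / \<epsilon>))"
proof -
  interpret strongly_convex_concave g \<mu>
    using assms(1,2,5,6) times_differentiable_imp_differentiable[OF assms(4)]
    by unfold_locales auto
  have "R \<noteq> 0" using assms(10,12) by auto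
  then have R: "R > 0" using assms(9) norm_ge_zero[of "z1 - zstar"] by linarith
  have \<delta>: "0 < run_accuracy p \<epsilon>" "run_accuracy p \<epsilon> < \<mu> * R\<^sup>2"
    using assms(10,12) by (auto simp: run_accuracy_def)
  have err: "norm (saddle_field g zh - taylor (saddle_field g) z (p - 1) zh)
      \<le> L / fact p * norm (zh - z) ^ p" for z zh
    using assms(1,4,7) by (intro taylor_error times_differentiable_saddle_field) auto
  have "duality_gap g out \<le> \<epsilon>"
    if "restarted_output (saddle_field g) p L \<mu> R (run_accuracy p \<epsilon>) z1 out" for out
  proof -
    have "duality_gap g out \<le> (if p = 1 then 9 / 2 else 1) * run_accuracy p \<epsilon>"
      by (rule restarted_output_gap[OF that assms(1,3) err assms(8) R assms(9) \<delta>])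
    \<comment> \<open>For \<open>p = 1\<close> the product is 9/2 * 1/5 = 9/10 times
      \<open>\<epsilon>\<close>; otherwise it is \<open>\<epsilon>\<close> itself.\<close>
    also have "\<dots> \<le> \<epsilon>" using assms(10) by (simp add: run_accuracy_def)
    finally show ?thesis .
  qed
  then show ?thesis
    using total_iterations_upper_bound[OF assms(1-3) R assms(10,12)] by blast
qed

end
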